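(* Let $(A_0,A_1)$ be a compatible couple of Banach spaces. Let $\theta\in(0,1)$ and let $q\in\mathcal{P}(\mathbb{R})$ be log-Hölder continuous both at the origin and at infinity. Then $$(A_0,A_1)_{\theta,q(\cdot),J}=(A_0,A_1)_{\theta,q(\cdot)},$$ with equivalence of norms.
   Context: Banach spaces $A_0,A_1$ (over $\mathbb{R}$ or $\mathbb{C}$) form a compatible couple $(A_0,A_1)$ if both embed continuously in a common Hausdorff topological vector space. $A_0+A_1$ is the set of $f=f_0+f_1$ with $f_i\in A_i$, normed by $\inf_{f=f_0+f_1}(\|f_0\|_{A_0}+\|f_1\|_{A_1})$; $A_0\cap A_1$ is normed by $\max(\|f\|_{A_0},\|f\|_{A_1})$. For $t>0$: $K(t,f)=\inf_{f=f_0+f_1}(\|f_0\|_{A_0}+t\|f_1\|_{A_1})$ for $f\in A_0+A_1$ (infimum over $f_i\in A_i$), and $J(t,f)=\max(\|f\|_{A_0},t\|f\|_{A_1})$ for $f\in A_0\cap A_1$. $\mathcal{P}(\mathbb{R})$ is the set of measurable functions $q:\mathbb{R}\to[1,\infty)$. For measurable $g$ on $(0,\infty)$, $\|g\|_{L^{q(\cdot)}((0,\infty),\frac{dt}{t})}=\inf\{\lambda>0:\int_0^\infty |g(t)/\lambda|^{q(t)}\frac{dt}{t}\le 1\}$. $q$ is log-Hölder continuous at the origin if there is $c>0$ with $|q(x)-q(0)|\le c/\ln(e+1/|x|)$ for all $x$; it is log-Hölder continuous at infinity if there are $q_\infty\in\mathbb{R}$ and $c>0$ with $|q(x)-q_\infty|\le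 c/\log(e+|x|)$ for all $x$. The space $(A_0,A_1)_{\theta,q(\cdot)}$ consists of all $f\in A_0+A_1$ for which $\|f\|_{(A_0,A_1)_{\theta,q(\cdot)}}=\|t^{-\theta}K(t,f)\|_{L^{q(\cdot)}((0,\infty),\frac{dt}{t})}$ is finite. The space $(A_0,A_1)_{\theta,q(\cdot),J}$ consists of all $f\in A_0+A_1$ representable as $f=\int_0^\infty u(t)\frac{dt}{t}$ (integral convergent in $A_0+A_1$), where $u:(0,\infty)\to A_0\cap A_1$ is (strongly) measurable, and for which $\|f\|_{(A_0,A_1)_{\theta,q(\cdot),J}}=\inf_u\|t^{-\theta}J(t,u(t))\|_{L^{q(\cdot)}((0,\infty),\frac{dt}{t})}$ is finite, the infimum being over all such representations. *)

theory Defs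
  imports "HOL-Analysis.Analysis"
begin

section \<open>Variable exponents\<close>

text \<open>The measure \<open>dt/t\<close> on \<open>(0, \<infinity>)\<close>; "measurable" means Lebesgue measurable throughout.\<close>

definition dt_over_t :: "real measure" where
  "dt_over_t = density (lebesgue_on {0<..}) (\<lambda>t. ennreal (1 / t))"

definition variable_exponents :: "(real \<Rightarrow> real) set" where
  "variable_exponents = {q. q \<in> borel_measurable lebesgue \<and> (\<forall>x. 1 \<le> q x)}"

text \<open>The infimum is taken in \<open>[0, \<infinity>]\<close>, so that the value is \<open>\<infinity>\<close> if no \<open>\<lambda>\<close> is admissible.\<close>

definition luxemburg_norm :: "(real \<Rightarrow> real) \<Rightarrow> (real \<Rightarrow> real) \<Rightarrow> ennreal" where
  "luxemburg_norm q g =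
     Inf (ennreal ` {l. 0 < l \<and> (\<integral>\<^sup>+t. ennreal (\<bar>g t / l\<bar> powr q t) \<partial>dt_over_t) \<le> 1})"

text \<open>At \<open>x = 0\<close> the convention \<open>1 / 0 = 0\<close> is harmless, as the left-hand side vanishes there.\<close>

definition log_Hoelder_at_origin :: "(real \<Rightarrow> real) \<Rightarrow> bool" where
  "log_Hoelder_at_origin q \<longleftrightarrow>
     (\<exists>c>0. \<forall>x. \<bar>q x - q 0\<bar> \<le> c / ln (exp 1 + 1 / \<bar>x\<bar>))"

definition log_Hoelder_at_infinity :: "(real \<Rightarrow> real) \<Rightarrow> bool" where
  "log_Hoelder_at_infinity q \<longleftrightarrow>
     (\<exists>q_inf. \<exists>c>0. \<forall>x. \<bar>q x - q_inf\<bar> \<le> c / ln (exp 1 + \<bar>x\<bar>))"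

section \<open>Bochner integration with respect to an explicitly given norm\<close>

text \<open>
  The library's Bochner integral takes values in a type that is a separable normed space. The sum
  and the intersection of a couple are normed subspaces of an ambient vector space, and need not
  be separable. So the library's definition is repeated here for functions into a subset \<open>S\<close> of a
  real vector space that carries the norm \<open>N\<close>; Borel measurability becomes strong measurability,
  i.e. being almost everywhere a limit of simple functions.
\<close>

definition strongly_measurable ::
    "'m measure \<Rightarrow> 'v set \<Rightarrow> ('v \<Rightarrow> real) \<Rightarrow> ('m \<Rightarrow> 'v::real_vector) \<Rightarrow> bool" where
  "strongly_measurable M S N u \<longleftrightarrow>
     (\<forall>t\<in>space M. u t \<in> S) \<and>
     (\<exists>s. (\<forall>n. simple_function M (s n) \<and> (\<forall>t\<in>space M. s n t \<in> S)) \<and>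
          (AE t in M. (\<lambda>n. N (u t - s n t)) \<longlonglongrightarrow> 0))"

definition has_Bochner_integral_wrt ::
    "'m measure \<Rightarrow> 'v set \<Rightarrow> ('v \<Rightarrow> real) \<Rightarrow> ('m \<Rightarrow> 'v::real_vector) \<Rightarrow> 'v \<Rightarrow> bool" where
  "has_Bochner_integral_wrt M S N u f \<longleftrightarrow>
     strongly_measurable M S N u \<and> f \<in> S \<and>
     (\<exists>s. (\<forall>n. Bochner_Integration.simple_bochner_integrable M (s n) \<and> (\<forall>t\<in>space M. s n t \<in> S)) \<and>
          (\<lambda>n. \<integral>\<^sup>+t. ennreal (N (u t - s n t)) \<partial>M) \<longlonglongrightarrow> 0 \<and>
          (\<lambda>n. N (Bochner_Integration.simple_bochner_integral M (s n) - f)) \<longlonglongrightarrow> 0)"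

section \<open>Compatible couples\<close>

text \<open>
  The Banach spaces are types \<open>'a\<close>, \<open>'b\<close>, and \<open>i\<^sub>0\<close>, \<open>i\<^sub>1\<close> are their embeddings into the Hausdorff
  topological vector space \<open>'v\<close>. The type classes provide a Hausdorff topological group under
  addition, and continuity of scalar multiplication is required explicitly. Complex couples are
  covered by restriction of scalars: sums, intersections, norms, the functionals \<open>K\<close> and \<open>J\<close> and
  Bochner integrals are the same over the real and over the complex scalars.
\<close>

definition compatible_couple ::
    "('a::banach \<Rightarrow> 'v::{real_vector, topological_ab_group_add, t2_space}) \<Rightarrow>
     ('b::banach \<Rightarrow> 'v) \<Rightarrow> bool" where
  "compatible_couple i\<^sub>0 i\<^sub>1 \<longleftrightarrow>
     continuous_on UNIV (\<lambda>(c::real, x::'v). c *\<^sub>R x) \<and>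
     linear i\<^sub>0 \<and> inj i\<^sub>0 \<and> continuous_on UNIV i\<^sub>0 \<and>
     linear i\<^sub>1 \<and> inj i\<^sub>1 \<and> continuous_on UNIV i\<^sub>1"

definition sum_space ::
    "('a::real_normed_vector \<Rightarrow> 'v::real_vector) \<Rightarrow> ('b::real_normed_vector \<Rightarrow> 'v) \<Rightarrow> 'v set" where
  "sum_space i\<^sub>0 i\<^sub>1 = {i\<^sub>0 a + i\<^sub>1 b | a b. True}"

definition sum_norm ::
    "('a::real_normed_vector \<Rightarrow> 'v::real_vector) \<Rightarrow> ('b::real_normed_vector \<Rightarrow> 'v) \<Rightarrow> 'v \<Rightarrow> real" where
  "sum_norm i\<^sub>0 i\<^sub>1 f = Inf {norm a + norm b | a b. f = i\<^sub>0 a + i\<^sub>1 b}"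

definition inter_space :: "('a \<Rightarrow> 'v) \<Rightarrow> ('b \<Rightarrow> 'v) \<Rightarrow> 'v set" where
  "inter_space i\<^sub>0 i\<^sub>1 = range i\<^sub>0 \<inter> range i\<^sub>1"

definition inter_norm ::
    "('a::real_normed_vector \<Rightarrow> 'v) \<Rightarrow> ('b::real_normed_vector \<Rightarrow> 'v) \<Rightarrow> 'v \<Rightarrow> real" where
  "inter_norm i\<^sub>0 i\<^sub>1 f = max (norm (inv i\<^sub>0 f)) (norm (inv i\<^sub>1 f))"

text \<open>
  As real-valued functions these are meaningful for \<open>t > 0\<close> and, respectively, for \<open>f\<close> in the sum
  and for \<open>f\<close> in the intersection of the couple.
\<close>

definition K_functional ::
    "('a::real_normed_vector \<Rightarrow> 'v::real_vector) \<Rightarrow> ('b::real_normed_vector \<Rightarrow> 'v) \<Rightarrow>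
     real \<Rightarrow> 'v \<Rightarrow> real" where
  "K_functional i\<^sub>0 i\<^sub>1 t f = Inf {norm a + t * norm b | a b. f = i\<^sub>0 a + i\<^sub>1 b}"

definition J_functional ::
    "('a::real_normed_vector \<Rightarrow> 'v) \<Rightarrow> ('b::real_normed_vector \<Rightarrow> 'v) \<Rightarrow> real \<Rightarrow> 'v \<Rightarrow> real" where
  "J_functional i\<^sub>0 i\<^sub>1 t f = max (norm (inv i\<^sub>0 f)) (t * norm (inv i\<^sub>1 f))"

section \<open>Interpolation spaces with variable exponent\<close>

definition K_norm ::
    "('a::real_normed_vector \<Rightarrow> 'v::real_vector) \<Rightarrow> ('b::real_normed_vector \<Rightarrow> 'v) \<Rightarrow>
     real \<Rightarrow> (real \<Rightarrow> real) \<Rightarrow> 'v \<Rightarrow> ennreal" where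
  "K_norm i\<^sub>0 i\<^sub>1 \<theta> q f = luxemburg_norm q (\<lambda>t. t powr (- \<theta>) * K_functional i\<^sub>0 i\<^sub>1 t f)"

definition K_space ::
    "('a::real_normed_vector \<Rightarrow> 'v::real_vector) \<Rightarrow> ('b::real_normed_vector \<Rightarrow> 'v) \<Rightarrow>
     real \<Rightarrow> (real \<Rightarrow> real) \<Rightarrow> 'v set" where
  "K_space i\<^sub>0 i\<^sub>1 \<theta> q = {f \<in> sum_space i\<^sub>0 i\<^sub>1. K_norm i\<^sub>0 i\<^sub>1 \<theta> q f < \<infinity>}"

text \<open>
  The functions \<open>u\<close> that represent \<open>f\<close>: strongly measurable into the intersection, with \<open>f\<close> as
  Bochner integral in the sum. Values of \<open>u\<close> outside \<open>(0, \<infinity>)\<close> are irrelevant.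
\<close>

definition J_representations ::
    "('a::real_normed_vector \<Rightarrow> 'v::real_vector) \<Rightarrow> ('b::real_normed_vector \<Rightarrow> 'v) \<Rightarrow>
     'v \<Rightarrow> (real \<Rightarrow> 'v) set" where
  "J_representations i\<^sub>0 i\<^sub>1 f =
     {u. strongly_measurable dt_over_t (inter_space i\<^sub>0 i\<^sub>1) (inter_norm i\<^sub>0 i\<^sub>1) u \<and>
         has_Bochner_integral_wrt dt_over_t (sum_space i\<^sub>0 i\<^sub>1) (sum_norm i\<^sub>0 i\<^sub>1) u f}"

definition J_norm ::
    "('a::real_normed_vector \<Rightarrow> 'v::real_vector) \<Rightarrow> ('b::real_normed_vector \<Rightarrow> 'v) \<Rightarrow>
     real \<Rightarrow> (real \<Rightarrow> real) \<Rightarrow> 'v \<Rightarrow> ennreal" where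
  "J_norm i\<^sub>0 i\<^sub>1 \<theta> q f =
     (INF u \<in> J_representations i\<^sub>0 i\<^sub>1 f.
        luxemburg_norm q (\<lambda>t. t powr (- \<theta>) * J_functional i\<^sub>0 i\<^sub>1 t (u t)))"

definition J_space ::
    "('a::real_normed_vector \<Rightarrow> 'v::real_vector) \<Rightarrow> ('b::real_normed_vector \<Rightarrow> 'v) \<Rightarrow>
     real \<Rightarrow> (real \<Rightarrow> real) \<Rightarrow> 'v set" where
  "J_space i\<^sub>0 i\<^sub>1 \<theta> q =
     {f \<in> sum_space i\<^sub>0 i\<^sub>1. J_representations i\<^sub>0 i\<^sub>1 f \<noteq> {} \<and> J_norm i\<^sub>0 i\<^sub>1 \<theta> q f < \<infinity>}"

end

theory Submission
  imports Defs
begin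

text \<open>
  If \<open>f = \<integral> u(s) ds/s\<close>, then \<open>K(t, f) \<le> \<integral> min(1, t/s) J(s, u(s)) ds/s\<close>, so that
  \<open>t powr - \<theta> * K(t, f)\<close> is dominated by the convolution on the multiplicative group \<open>(0, \<infinity>)\<close> of
  \<open>s powr - \<theta> * J(s, u(s))\<close> with the kernel \<open>exp (- d \<bar>ln s - ln t\<bar>)\<close>, where
  \<open>d = min \<theta> (1 - \<theta>)\<close>. This convolution is bounded on the variable exponent space: in the
  variable \<open>ln t\<close> the exponent approaches its limits at \<open>\<plusminus>\<infinity>\<close> at the rate \<open>1 / \<bar>ln t\<bar>\<close>, which the
  exponential decay of the kernel compensates.

  Conversely, near-optimal decompositions of \<open>f\<close> at the points \<open>t = 2 ^ j\<close> telescope to a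
  representation \<open>u\<close> with \<open>J(t, u(t)) \<le> C K(t, f)\<close> pointwise. It converges because a finite norm
  forces \<open>K(t, f) = O(t powr \<theta>)\<close>.
\<close>

section \<open>Convolution with a logarithmic kernel\<close>

text \<open>The estimate is made on modulars instead, for functions of modular at most
  \<open>1\<close>. Passing from the exponent \<open>q t\<close> to \<open>q s\<close> costs a
  factor \<open>g powr (q t - q s)\<close>, which is under control only while the product of \<bar>q
  t - q s\<bar> and \<bar>ln g\<bar> stays bounded. Extremely small values of \<open>g\<close> are
  therefore charged to an error that does not depend on \<open>g\<close> and has a finite double
  integral. The resulting bound is a constant, not a multiple of the modular; since
  \<open>q \<ge> 1\<close>, rescaling the function turns this constant into \<open>1\<close>.

  A second obstacle is measurability: strong measurability of \<open>u\<close> yields measurable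
  versions of the scalar functions built from it only up to null sets, and the integrals that define
  Bochner convergence may have non-measurable integrands. The limit arguments use monotonicity there
  and keep additivity for measurable substitutes.\<close>

lemma space_dt_over_t [simp]: "space dt_over_t = {0<..}"
  by (simp add: dt_over_t_def)

lemma borel_measurable_dt_over_t:
  "f \<in> borel_measurable lebesgue \<Longrightarrow> f \<in> borel_measurable dt_over_t"
  unfolding dt_over_t_def by (simp add: measurable_restrict_space1)

lemma borel_imp_borel_measurable_dt_over_t [intro]:
  "f \<in> borel_measurable borel \<Longrightarrow> f \<in> borel_measurable dt_over_t"
  by (intro borel_measurable_dt_over_t measurable_completion) simp

lemma nn_integral_dt_over_t:
  assumes "f \<in> borel_measurable borel"
  shows "(\<integral>\<^sup>+t. f t \<partial>dt_over_t) = (\<integral>\<^sup>+t. ennreal (1 / t) * f t * indicator {0<..} t \<partial>lborel)"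
proof -
  have *: "g \<in> borel_measurable (lebesgue_on {0<..})" if "g \<in> borel_measurable borel"
    for g :: "real \<Rightarrow> ennreal"
    using that by (intro measurable_restrict_space1 measurable_completion) simp
  have "(\<integral>\<^sup>+t. f t \<partial>dt_over_t) = (\<integral>\<^sup>+t. ennreal (1 / t) * f t \<partial>lebesgue_on {0<..})"
    unfolding dt_over_t_def by (rule nn_integral_density; rule *) (use assms in simp_all)
  also have "\<dots> = (\<integral>\<^sup>+t. ennreal (1 / t) * f t * indicator {0<..} t \<partial>lebesgue)"
    by (rule nn_integral_restrict_space) auto
  finally show ?thesis by (simp add: nn_integral_completion)
qed

lemma sigma_finite_lebesgue: "sigma_finite_measure (lebesgue :: real measure)"
proof
  obtain A :: "real set set" where "countable A" "A \<subseteq> sets lborel" "\<Union> A = space lborel"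
      "\<forall>a\<in>A. emeasure lborel a \<noteq> \<infinity>"
    using lborel.sigma_finite_countable by blast
  then show "\<exists>A. countable A \<and> A \<subseteq> sets (lebesgue :: real measure) \<and>
      \<Union> A = space lebesgue \<and> (\<forall>a\<in>A. emeasure lebesgue a \<noteq> \<infinity>)"
    by (intro exI[of _ A]) (auto intro: sets_completionI_sets simp: subset_eq)
qed

text \<open>The exchange of the two integrations in the convolution estimate rests on this. It
  passes from Lebesgue measure to the density because \<open>1 / t\<close> is finite
  everywhere.\<close>

lemma sigma_finite_dt_over_t: "sigma_finite_measure dt_over_t"
proof -
  interpret sigma_finite_measure "lebesgue_on {0<..} :: real measure"
    by (rule sigma_finite_measure_restrict_space) (auto intro: sigma_finite_lebesgue)
  have *: "(\<lambda>t. ennreal (1 / t)) \<in> borel_measurable (lebesgue_on {0<..})"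
    by (intro measurable_restrict_space1 measurable_completion) simp
  show ?thesis
    unfolding dt_over_t_def using sigma_finite_iff_density_finite[OF *] by simp
qed

lemma nn_integral_log_kernel_le:
  assumes d: "0 < d" and s: "0 < s"
  shows "(\<integral>\<^sup>+t. ennreal (exp (- d * \<bar>ln s - ln t\<bar>)) \<partial>dt_over_t) \<le> ennreal (2 / d)"
proof -
  have "(\<integral>\<^sup>+t. ennreal (exp (- d * \<bar>ln s - ln t\<bar>)) \<partial>dt_over_t) =
    (\<integral>\<^sup>+t. ennreal (1 / t) * ennreal (exp (- d * \<bar>ln s - ln t\<bar>)) * indicator {0<..} t \<partial>lborel)"
    by (rule nn_integral_dt_over_t) measurable
  \<comment> \<open>Both indicators contain \<open>t = s\<close>, so the integrand is only dominated
    by the sum.\<close>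
  also have "\<dots> \<le> (\<integral>\<^sup>+t. ennreal (s powr - d) * (ennreal (t powr (d - 1)) * indicator {0..s} t) +
      ennreal (s powr d) * (ennreal (t powr (- d - 1)) * indicator {s..} t) \<partial>lborel)"
  proof (rule nn_integral_mono)
    fix t :: real
    have inv: "1 / t = exp (- ln t)" if "0 < t"
      using that by (simp add: exp_minus inverse_eq_divide)
    consider "t \<le> 0" | "0 < t" "t \<le> s" | "s < t" by linarith
    then show "ennreal (1 / t) * ennreal (exp (- d * \<bar>ln s - ln t\<bar>)) * indicator {0<..} t \<le>
      ennreal (s powr - d) * (ennreal (t powr (d - 1)) * indicator {0..s} t) +
      ennreal (s powr d) * (ennreal (t powr (- d - 1)) * indicator {s..} t)"
    proof cases
      case 2
      then have "\<bar>ln s - ln t\<bar> = ln s - ln t" using s by simp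
      then have "1 / t * exp (- d * \<bar>ln s - ln t\<bar>) = s powr - d * t powr (d - 1)"
        using inv 2 s by (simp add: powr_def exp_add[symmetric] algebra_simps)
      then show ?thesis using 2 s
        by (simp add: ennreal_mult[symmetric] indicator_def)
    next
      case 3
      then have "\<bar>ln s - ln t\<bar> = ln t - ln s" using s by simp
      then have "1 / t * exp (- d * \<bar>ln s - ln t\<bar>) = s powr d * t powr (- d - 1)"
        using inv 3 s by (simp add: powr_def exp_add[symmetric] algebra_simps)
      then show ?thesis using 3 s
        by (simp add: ennreal_mult[symmetric] indicator_def)
    qed auto
  qed
  also have "\<dots> = ennreal (s powr - d) * (\<integral>\<^sup>+t. ennreal (t powr (d - 1)) * indicator {0..s} t \<partial>lborel) +
      ennreal (s powr d) * (\<integral>\<^sup>+t. ennreal (t powr (- d - 1)) * indicator {s..} t \<partial>lborel)"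
    by (subst nn_integral_add) (auto simp: nn_integral_cmult)
  also have "(\<integral>\<^sup>+t. ennreal (t powr (d - 1)) * indicator {0..s} t \<partial>lborel) = ennreal (s powr d / d)"
    using has_integral_powr_from_0[of "d - 1" s] d s
    by (intro nn_integral_has_integral_lebesgue') auto
  also have "(\<integral>\<^sup>+t. ennreal (t powr (- d - 1)) * indicator {s..} t \<partial>lborel) = ennreal (s powr - d / d)"
    using has_integral_powr_to_inf[of "- d - 1" s] d s
    by (intro nn_integral_has_integral_lebesgue') auto
  also have "ennreal (s powr - d) * ennreal (s powr d / d) + ennreal (s powr d) * ennreal (s powr - d / d)
    = ennreal (2 / d)"
    using d s by (simp add: ennreal_mult[symmetric] ennreal_plus[symmetric] powr_minus field_simps
        del: ennreal_plus)
  finally show ?thesis .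
qed

text \<open>The denominators \<open>ln (exp 1 + 1 / \<bar>x\<bar>)\<close> and
  \<open>ln (exp 1 + \<bar>x\<bar>)\<close> dominate \<open>- ln x\<close> and \<open>ln x\<close>,
  so comparing both values of \<open>q\<close> with their common limit costs at most a constant over
  \<open>m\<close>. The product form admits \<open>m = 0\<close>, where nothing is claimed about the
  oscillation.\<close>

lemma log_Hoelder_oscillation:
  assumes "log_Hoelder_at_origin q" "log_Hoelder_at_infinity q"
  obtains c where "0 \<le> c"
    "\<And>s t m. 0 < s \<Longrightarrow> 0 < t \<Longrightarrow> 0 \<le> m \<Longrightarrow>
      m \<le> - ln s \<and> m \<le> - ln t \<or> m \<le> ln s \<and> m \<le> ln t \<Longrightarrow> \<bar>q s - q t\<bar> * m \<le> c"
proof -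
  obtain c0 where c0: "0 < c0" "\<And>x. \<bar>q x - q 0\<bar> \<le> c0 / ln (exp 1 + 1 / \<bar>x\<bar>)"
    using assms(1) unfolding log_Hoelder_at_origin_def by blast
  obtain c1 q1 where c1: "0 < c1" "\<And>x. \<bar>q x - q1\<bar> \<le> c1 / ln (exp 1 + \<bar>x\<bar>)"
    using assms(2) unfolding log_Hoelder_at_infinity_def by blast
  have aux: "y * m \<le> c" if "y \<le> c / l" "0 < l" "0 \<le> m" "m \<le> l" "0 < c" for y c l m :: real
  proof -
    have "y * m \<le> c / l * m" using that by (intro mult_right_mono) auto
    also have "\<dots> \<le> c / l * l" using that by (intro mult_left_mono) auto
    finally show ?thesis using that by simp
  qed
  have origin: "\<bar>q s - q 0\<bar> * m \<le> c0" if "0 < s" "0 \<le> m" "m \<le> - ln s" for s m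
  proof (rule aux[OF c0(2) _ that(2) _ c0(1)])
    have "ln (1 / s) \<le> ln (exp 1 + 1 / \<bar>s\<bar>)"
      using that by (subst ln_le_cancel_iff) (auto intro: add_pos_pos)
    then show "m \<le> ln (exp 1 + 1 / \<bar>s\<bar>)" using that by (simp add: ln_div)
    show "0 < ln (exp 1 + 1 / \<bar>s\<bar>)"
      by (rule ln_gt_zero) (use one_less_exp_iff[of "1::real"] in \<open>smt (verit) divide_nonneg_nonneg\<close>)
  qed
  have infinity: "\<bar>q s - q1\<bar> * m \<le> c1" if "0 < s" "0 \<le> m" "m \<le> ln s" for s m
  proof (rule aux[OF c1(2) _ that(2) _ c1(1)])
    have "ln s \<le> ln (exp 1 + \<bar>s\<bar>)"
      using that by (subst ln_le_cancel_iff) (auto intro: add_pos_pos)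
    then show "m \<le> ln (exp 1 + \<bar>s\<bar>)" using that by simp
    show "0 < ln (exp 1 + \<bar>s\<bar>)"
      by (rule ln_gt_zero) (use one_less_exp_iff[of "1::real"] in linarith)
  qed
  show ?thesis
  proof (rule that[of "2 * max c0 c1"])
    show "0 \<le> 2 * max c0 c1" using c0(1) by (simp add: max_def)
    fix s t m :: real
    assume st: "0 < s" "0 < t" "0 \<le> m" and "m \<le> - ln s \<and> m \<le> - ln t \<or> m \<le> ln s \<and> m \<le> ln t"
    then consider "m \<le> - ln s" "m \<le> - ln t" | "m \<le> ln s" "m \<le> ln t" by blast
    then show "\<bar>q s - q t\<bar> * m \<le> 2 * max c0 c1"
    proof cases
      case 1
      have "\<bar>q s - q t\<bar> * m \<le> (\<bar>q s - q 0\<bar> + \<bar>q t - q 0\<bar>) * m"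
        using st by (intro mult_right_mono) auto
      also have "\<dots> \<le> c0 + c0"
        using origin[of s m] origin[of t m] st 1 by (simp add: distrib_right)
      finally show ?thesis by simp
    next
      case 2
      have "\<bar>q s - q t\<bar> * m \<le> (\<bar>q s - q1\<bar> + \<bar>q t - q1\<bar>) * m"
        using st by (intro mult_right_mono) auto
      also have "\<dots> \<le> c1 + c1"
        using infinity[of s m] infinity[of t m] st 2 by (simp add: distrib_right)
      finally show ?thesis by simp
    qed
  qed
qed

text \<open>
  The exponent at \<open>t\<close> is exchanged for the one at \<open>s\<close> where \<open>g \<ge> exp (- r m)\<close>, with \<open>m\<close> the
  distance of \<open>{ln s, ln t}\<close> from \<open>0\<close> if both have the same sign and \<open>m = 0\<close> otherwise. For
  smaller \<open>g\<close> half of the decay of the kernel is spent.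
\<close>

lemma kernel_exponent_exchange:
  fixes q :: "real \<Rightarrow> real"
  assumes osc: "\<And>s t m. 0 < s \<Longrightarrow> 0 < t \<Longrightarrow> 0 \<le> m \<Longrightarrow>
      m \<le> - ln s \<and> m \<le> - ln t \<or> m \<le> ln s \<and> m \<le> ln t \<Longrightarrow> \<bar>q s - q t\<bar> * m \<le> c"
    and q: "1 \<le> q t" and c: "0 \<le> c" and r: "0 \<le> r" and pos: "0 < s" "0 < t" and g: "0 \<le> g" "g \<le> 1"
  shows "exp (- (2 * r) * \<bar>ln s - ln t\<bar>) * g powr q t \<le>
    exp (r * c) * (exp (- (2 * r) * \<bar>ln s - ln t\<bar>) * g powr q s) +
    exp (- r * \<bar>ln s - ln t\<bar>) * exp (- r * \<bar>ln t\<bar>)"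
proof -
  define m where "m = (if 0 \<le> ln s \<and> 0 \<le> ln t \<or> ln s \<le> 0 \<and> ln t \<le> 0 then min \<bar>ln s\<bar> \<bar>ln t\<bar> else 0)"
  \<comment> \<open>The choice of \<open>m\<close> aims at this inequality: for logarithms of
    opposite sign \<open>\<bar>ln t\<bar>\<close> is already at most their distance, and for equal
    signs the triangle inequality gives it.\<close>
  have m: "0 \<le> m" "\<bar>ln t\<bar> \<le> \<bar>ln s - ln t\<bar> + m" by (auto simp: m_def)
  have qm: "\<bar>q s - q t\<bar> * m \<le> c"
  proof (cases "m = 0")
    case True
    then show ?thesis using c by simp
  next
    case False
    then show ?thesis using pos m(1) by (intro osc) (auto simp: m_def split: if_splits)
  qed
  show ?thesis
  \<comment> \<open>Above the threshold \<open>\<bar>ln g\<bar> \<le> r * m\<close>, so the factor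
    \<open>g powr (q t - q s)\<close> is at most
    \<open>exp (r * (\<bar>q s - q t\<bar> * m))\<close>, hence at most
    \<open>exp (r * c)\<close>.\<close>
  proof (cases "exp (- r * m) \<le> g")
    case True
    have "0 < g" using True by (smt (verit) exp_gt_zero)
    have "- r * m \<le> ln g" using True \<open>0 < g\<close> by (metis exp_gt_zero ln_exp ln_le_cancel_iff)
    have "(q t - q s) * ln g \<le> \<bar>q t - q s\<bar> * \<bar>ln g\<bar>"
      by (metis abs_ge_self abs_mult)
    also have "\<dots> \<le> \<bar>q t - q s\<bar> * (r * m)"
      using \<open>- r * m \<le> ln g\<close> \<open>0 < g\<close> g by (intro mult_left_mono) auto
    also have "\<dots> = r * (\<bar>q s - q t\<bar> * m)" by (simp add: abs_minus_commute)
    also have "\<dots> \<le> r * c" using qm r by (rule mult_left_mono)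
    finally have "exp ((q t - q s) * ln g) \<le> exp (r * c)" by simp
    then have "exp ((q t - q s) * ln g) * g powr q s \<le> exp (r * c) * g powr q s"
      by (rule mult_right_mono) simp
    moreover have "g powr q t = exp ((q t - q s) * ln g) * g powr q s"
      using \<open>0 < g\<close> by (simp add: powr_def exp_add[symmetric] algebra_simps)
    ultimately have "exp (- (2 * r) * \<bar>ln s - ln t\<bar>) * g powr q t
        \<le> exp (- (2 * r) * \<bar>ln s - ln t\<bar>) * (exp (r * c) * g powr q s)"
      by (intro mult_left_mono) simp_all
    moreover have "0 \<le> exp (- r * \<bar>ln s - ln t\<bar>) * exp (- r * \<bar>ln t\<bar>)" by simp
    ultimately show ?thesis by (simp only: mult_ac)
  next
    case False
    have "g powr q t \<le> g"
      using powr_mono'[OF q g] g by (cases "g = 0") simp_all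
    then have "exp (- (2 * r) * \<bar>ln s - ln t\<bar>) * g powr q t
        \<le> exp (- (2 * r) * \<bar>ln s - ln t\<bar>) * exp (- r * m)"
      using False by (intro mult_left_mono) auto
    \<comment> \<open>Half of the kernel together with \<open>exp (- r * m)\<close> pays for decay
      in \<open>\<bar>ln t\<bar>\<close>. The result no longer contains \<open>g\<close> and is
      integrable in both variables.\<close>
    also have "\<dots> \<le> exp (- r * \<bar>ln s - ln t\<bar>) * exp (- r * \<bar>ln t\<bar>)"
    proof -
      have "r * \<bar>ln t\<bar> \<le> r * (\<bar>ln s - ln t\<bar> + m)" using m(2) r by (rule mult_left_mono)
      then show ?thesis by (simp add: exp_add[symmetric] algebra_simps)
    qed
    finally show ?thesis by (smt (verit) exp_ge_zero mult_nonneg_nonneg powr_ge_zero)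
  qed
qed

text \<open>A form of Jensen's inequality for a weight whose mass is only bounded above, at the
  price of the factor \<open>2\<close>. Convexity is replaced by
  \<open>g \<le> b + b powr (1 - p) * g powr p\<close>: this is trivial for
  \<open>g \<le> b\<close>, and above \<open>b\<close> it holds because the exponent
  \<open>1 - p\<close> is not positive.\<close>

lemma nn_integral_weighted_powr_ge:
  fixes w g :: "'a \<Rightarrow> real"
  assumes [measurable]: "w \<in> borel_measurable M" "g \<in> borel_measurable M"
    and nonneg: "\<And>x. x \<in> space M \<Longrightarrow> 0 \<le> w x" "\<And>x. x \<in> space M \<Longrightarrow> 0 \<le> g x"
    and mass: "(\<integral>\<^sup>+x. ennreal (w x) \<partial>M) \<le> ennreal B" and B: "0 < B"
    and a: "0 \<le> a" "ennreal a \<le> (\<integral>\<^sup>+x. ennreal (w x * g x) \<partial>M)" and p: "1 \<le> p"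
  shows "ennreal (B * (a / (2 * B)) powr p) \<le> (\<integral>\<^sup>+x. ennreal (w x * g x powr p) \<partial>M)"
proof (cases "a = 0 \<or> (\<integral>\<^sup>+x. ennreal (w x * g x powr p) \<partial>M) = \<infinity>")
  case False
  \<comment> \<open>With this threshold the constant part contributes at most
    \<open>b * B = a / 2\<close>; the other half of \<open>a\<close> must come from the
    \<open>p\<close>-th powers.\<close>
  define b where "b = a / (2 * B)"
  have b: "0 < b" using a B False by (simp add: b_def)
  obtain I where I: "0 \<le> I" "(\<integral>\<^sup>+x. ennreal (w x * g x powr p) \<partial>M) = ennreal I"
    using False by (cases "\<integral>\<^sup>+x. ennreal (w x * g x powr p) \<partial>M") auto
  have "ennreal a \<le> (\<integral>\<^sup>+x. ennreal (w x * g x) \<partial>M)" by fact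
  also have "\<dots> \<le> (\<integral>\<^sup>+x. ennreal b * ennreal (w x) +
      ennreal (b powr (1 - p)) * ennreal (w x * g x powr p) \<partial>M)"
  proof (rule nn_integral_mono)
    fix x assume x: "x \<in> space M"
    have "g x \<le> b + b powr (1 - p) * g x powr p"
    proof (cases "g x \<le> b")
      case True
      then show ?thesis by (simp add: add_increasing2)
    next
      case False
      then have "0 < g x" using b by simp
      then have "g x = (g x) powr (1 - p) * (g x) powr p"
        by (simp add: powr_add[symmetric])
      also have "\<dots> \<le> b powr (1 - p) * (g x) powr p"
        using False b p by (intro mult_right_mono powr_mono2') auto
      finally show ?thesis using b by simp
    qed
    then have "w x * g x \<le> w x * (b + b powr (1 - p) * g x powr p)"
      using nonneg(1)[OF x] by (rule mult_left_mono)
    then have "w x * g x \<le> b * w x + b powr (1 - p) * (w x * g x powr p)"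
      by (simp add: algebra_simps)
    then show "ennreal (w x * g x) \<le> ennreal b * ennreal (w x) +
        ennreal (b powr (1 - p)) * ennreal (w x * g x powr p)"
      using nonneg(1)[OF x] b
      by (simp add: ennreal_mult[symmetric] ennreal_plus[symmetric] ennreal_leI del: ennreal_plus)
  qed
  also have "\<dots> = ennreal b * (\<integral>\<^sup>+x. ennreal (w x) \<partial>M) +
      ennreal (b powr (1 - p)) * (\<integral>\<^sup>+x. ennreal (w x * g x powr p) \<partial>M)"
    by (subst nn_integral_add) (auto simp: nn_integral_cmult)
  also have "\<dots> \<le> ennreal b * ennreal B + ennreal (b powr (1 - p)) * ennreal I"
    unfolding I(2) by (intro add_right_mono mult_left_mono mass) simp
  also have "\<dots> = ennreal (b * B + b powr (1 - p) * I)"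
    using b B I(1) by (simp add: ennreal_mult ennreal_plus)
  finally have "a \<le> b * B + b powr (1 - p) * I"
    using b B I(1) by (subst (asm) ennreal_le_iff) auto
  moreover have "a = 2 * (b * B)" using B by (simp add: b_def)
  ultimately have "b * B \<le> b powr (1 - p) * I" by linarith
  then have "b powr (p - 1) * (b * B) \<le> b powr (p - 1) * (b powr (1 - p) * I)"
    by (rule mult_left_mono) simp
  moreover have "b powr (p - 1) * b = b powr p"
    using b by (simp add: powr_mult_base mult.commute)
  moreover have "b powr (p - 1) * b powr (1 - p) = 1"
    using b by (simp add: powr_add[symmetric])
  ultimately have "B * b powr p \<le> I"
    by (metis mult.assoc mult.commute mult_1)
  then show ?thesis unfolding I(2) b_def by (rule ennreal_leI)
qed auto

text \<open>
  The part of \<open>g\<close> above \<open>1\<close> is mapped into functions bounded by \<open>1\<close>, for which the exponent can be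
  dropped. On the part below \<open>1\<close> the exponents are exchanged.
\<close>

lemma log_convolution_modular_bound:
  assumes q: "q \<in> variable_exponents" "log_Hoelder_at_origin q" "log_Hoelder_at_infinity q"
    and d: "0 < d" "d \<le> 1"
  obtains B where "0 < B"
    "\<And>g h. g \<in> borel_measurable dt_over_t \<Longrightarrow> (\<And>s. 0 < s \<Longrightarrow> 0 \<le> g s) \<Longrightarrow>
      (\<integral>\<^sup>+s. ennreal (g s powr q s) \<partial>dt_over_t) \<le> 1 \<Longrightarrow>
      (\<And>t. 0 < t \<Longrightarrow> 0 \<le> h t) \<Longrightarrow>
      (\<And>t. 0 < t \<Longrightarrow>
        ennreal (h t) \<le> (\<integral>\<^sup>+s. ennreal (exp (- d * \<bar>ln s - ln t\<bar>) * g s) \<partial>dt_over_t)) \<Longrightarrow>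
      (\<integral>\<^sup>+t. ennreal ((h t / B) powr q t) \<partial>dt_over_t) \<le> 1"
proof -
  obtain c where c: "0 \<le> c" and osc: "\<And>s t m. 0 < s \<Longrightarrow> 0 < t \<Longrightarrow> 0 \<le> m \<Longrightarrow>
      m \<le> - ln s \<and> m \<le> - ln t \<or> m \<le> ln s \<and> m \<le> ln t \<Longrightarrow> \<bar>q s - q t\<bar> * m \<le> c"
    using log_Hoelder_oscillation[OF q(2,3)] by blast
  define k where "k s t = exp (- d * \<bar>ln s - ln t\<bar>)" for s t :: real
  define r where "r = d / 2"
  define e where "e s t = exp (- r * \<bar>ln s - ln t\<bar>) * exp (- r * \<bar>ln t\<bar>)" for s t :: real
  define A where "A = 2 / d"
  define C where "C = exp (r * c)"
  \<comment> \<open>\<open>C * A\<close> will come from the part of \<open>g\<close> below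
    \<open>1\<close>, \<open>A\<close> from the part above, and the last term from the double
    integral of \<open>e\<close>.\<close>
  define B where "B = (C + 1) * A + (2 / r) * (2 / r)"
  have r: "0 < r" and A: "2 \<le> A" using d by (auto simp: r_def A_def field_simps)
  have C: "0 < C" by (simp add: C_def)
  have "1 * 2 \<le> (C + 1) * A" using A C by (intro mult_mono) auto
  moreover have "0 \<le> (2 / r) * (2 / r)" using r by simp
  ultimately have B: "1 \<le> B" unfolding B_def by linarith
  have q1: "1 \<le> q t" for t using q(1) by (simp add: variable_exponents_def)
  have [measurable]: "q \<in> borel_measurable dt_over_t"
    using q(1) by (auto simp: variable_exponents_def intro: borel_measurable_dt_over_t)
  have [measurable]: "(\<lambda>t. ln t :: real) \<in> borel_measurable dt_over_t"
    by (rule borel_imp_borel_measurable_dt_over_t) measurable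
  have [measurable]: "(\<lambda>s. k s t) \<in> borel_measurable dt_over_t"
      "(\<lambda>s. e s t) \<in> borel_measurable dt_over_t" for t
    unfolding k_def e_def by measurable
  have [measurable]: "(\<lambda>x. ln (fst x)) \<in> borel_measurable (dt_over_t \<Otimes>\<^sub>M dt_over_t)"
      "(\<lambda>x. ln (snd x)) \<in> borel_measurable (dt_over_t \<Otimes>\<^sub>M dt_over_t)"
    by measurable
  have kernel_mass: "(\<integral>\<^sup>+s. ennreal (k s t) \<partial>dt_over_t) \<le> ennreal A"
      "(\<integral>\<^sup>+s. ennreal (k t s) \<partial>dt_over_t) \<le> ennreal A" if "0 < t" for t
    using nn_integral_log_kernel_le[OF d(1) that]
    by (simp_all add: k_def A_def abs_minus_commute)
  interpret dt: sigma_finite_measure dt_over_t by (rule sigma_finite_dt_over_t)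
  interpret pair_sigma_finite dt_over_t dt_over_t ..
  have e_mass: "(\<integral>\<^sup>+t. \<integral>\<^sup>+s. ennreal (e s t) \<partial>dt_over_t \<partial>dt_over_t) \<le> ennreal ((2 / r) * (2 / r))"
  proof -
    have "(\<integral>\<^sup>+s. ennreal (e s t) \<partial>dt_over_t) \<le> ennreal (2 / r) * ennreal (exp (- r * \<bar>ln t\<bar>))"
      if "0 < t" for t
    proof -
      have "(\<integral>\<^sup>+s. ennreal (e s t) \<partial>dt_over_t) =
          (\<integral>\<^sup>+s. ennreal (exp (- r * \<bar>ln t - ln s\<bar>)) * ennreal (exp (- r * \<bar>ln t\<bar>)) \<partial>dt_over_t)"
        by (simp add: e_def ennreal_mult abs_minus_commute)
      also have "\<dots> = (\<integral>\<^sup>+s. ennreal (exp (- r * \<bar>ln t - ln s\<bar>)) \<partial>dt_over_t) * ennreal (exp (- r * \<bar>ln t\<bar>))"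
        by (rule nn_integral_multc) measurable
      also have "\<dots> \<le> ennreal (2 / r) * ennreal (exp (- r * \<bar>ln t\<bar>))"
        by (intro mult_right_mono nn_integral_log_kernel_le r that) simp
      finally show ?thesis .
    qed
    then have "(\<integral>\<^sup>+t. \<integral>\<^sup>+s. ennreal (e s t) \<partial>dt_over_t \<partial>dt_over_t) \<le>
        (\<integral>\<^sup>+t. ennreal (2 / r) * ennreal (exp (- r * \<bar>ln t\<bar>)) \<partial>dt_over_t)"
      by (intro nn_integral_mono) simp
    also have "\<dots> = ennreal (2 / r) * (\<integral>\<^sup>+t. ennreal (exp (- r * \<bar>ln t\<bar>)) \<partial>dt_over_t)"
      by (rule nn_integral_cmult) measurable
    \<comment> \<open>As \<open>ln 1 = 0\<close>, the remaining factor is the kernel centred at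
      \<open>1\<close>.\<close>
    also have "\<dots> \<le> ennreal (2 / r) * ennreal (2 / r)"
      using nn_integral_log_kernel_le[OF r, of 1] by (intro mult_left_mono) simp_all
    finally show ?thesis using r by (simp add: ennreal_mult[symmetric])
  qed
  show ?thesis
  \<comment> \<open>Division by \<open>4 * A\<close> gives the pointwise estimate below;
    \<open>B\<close> then scales the integrated bound to \<open>1\<close>.\<close>
  proof (rule that[of "4 * A * B"])
    show "0 < 4 * A * B" using A B by simp
    fix g h :: "real \<Rightarrow> real"
    assume g[measurable]: "g \<in> borel_measurable dt_over_t" and g0: "\<And>s. 0 < s \<Longrightarrow> 0 \<le> g s"
      and modular: "(\<integral>\<^sup>+s. ennreal (g s powr q s) \<partial>dt_over_t) \<le> 1"
      and h0: "\<And>t. 0 < t \<Longrightarrow> 0 \<le> h t"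
      and h: "\<And>t. 0 < t \<Longrightarrow>
        ennreal (h t) \<le> (\<integral>\<^sup>+s. ennreal (exp (- d * \<bar>ln s - ln t\<bar>) * g s) \<partial>dt_over_t)"
    define G where "G s = ennreal (g s powr q s)" for s
    have [measurable]: "G \<in> borel_measurable dt_over_t" unfolding G_def by measurable
    have pointwise: "ennreal ((h t / (4 * A)) powr q t) \<le>
        ennreal (C + 1) * (\<integral>\<^sup>+s. ennreal (k s t) * G s \<partial>dt_over_t) + (\<integral>\<^sup>+s. ennreal (e s t) \<partial>dt_over_t)"
      if t: "0 < t" for t
    proof -
      define g1 where "g1 s = (if g s \<le> 1 then g s else 0)" for s
      define g2 where "g2 s = (if g s \<le> 1 then 0 else g s)" for s
      have [measurable]: "g1 \<in> borel_measurable dt_over_t" "g2 \<in> borel_measurable dt_over_t"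
        unfolding g1_def g2_def by measurable
      have g1: "0 \<le> g1 s" "g1 s \<le> 1" and g2: "0 \<le> g2 s" if "0 < s" for s
        using g0[OF that] by (auto simp: g1_def g2_def)
      have k01: "0 \<le> k s u" "k s u \<le> 1" for s u using d by (auto simp: k_def)
      have g1q: "g1 s powr q s \<le> g s powr q s" if "0 < s" for s
        by (simp add: g1_def)
      have g2q: "g2 s \<le> g s powr q s" if "0 < s" for s
      proof (cases "g s \<le> 1")
        case False
        then show ?thesis using powr_mono[OF q1, of "g s" s] by (simp add: g2_def)
      qed (simp add: g2_def)
      define F1 where "F1 = (\<integral>\<^sup>+s. ennreal (k s t * g1 s) \<partial>dt_over_t)"
      define F2 where "F2 = (\<integral>\<^sup>+s. ennreal (k s t * g2 s) \<partial>dt_over_t)"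
      have "F1 \<le> (\<integral>\<^sup>+s. ennreal (k s t) \<partial>dt_over_t)"
        unfolding F1_def using g1 k01
        by (intro nn_integral_mono ennreal_leI) (auto intro: mult_left_le)
      then have "F1 \<le> ennreal A" using kernel_mass(1)[OF t] by (rule order_trans)
      then obtain a where a: "0 \<le> a" "F1 = ennreal a"
        by (cases F1) (auto simp: top_unique)
      have F2G: "F2 \<le> (\<integral>\<^sup>+s. ennreal (k s t) * G s \<partial>dt_over_t)"
        unfolding F2_def G_def using g2q k01
        by (intro nn_integral_mono) (auto simp: ennreal_mult[symmetric] intro!: ennreal_leI mult_left_mono)
      also have "\<dots> \<le> (\<integral>\<^sup>+s. 1 * G s \<partial>dt_over_t)"
        using k01 by (intro nn_integral_mono mult_right_mono) auto
      also have "\<dots> \<le> 1" using modular by (simp add: G_def)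
      finally have "F2 \<le> ennreal 1" by simp
      then obtain b where b: "0 \<le> b" "b \<le> 1" "F2 = ennreal b"
        by (cases F2) (auto simp: top_unique)
      have "ennreal (h t) \<le> (\<integral>\<^sup>+s. ennreal (k s t * g1 s) + ennreal (k s t * g2 s) \<partial>dt_over_t)"
        using h[OF t] by (rule order_trans)
          (intro nn_integral_mono, auto simp: k_def g1_def g2_def)
      also have "\<dots> = F1 + F2"
        unfolding F1_def F2_def by (rule nn_integral_add) measurable
      also have "\<dots> = ennreal (a + b)" using a b by simp
      finally have "h t \<le> a + b" using a b by (subst (asm) ennreal_le_iff) auto
      \<comment> \<open>Powers of sums are avoided by comparing \<open>h t\<close> with twice the
        larger of \<open>a\<close> and \<open>b\<close>. If that is \<open>b\<close>, then
        \<open>b \<le> 1\<close> lets the exponent be dropped; if it is \<open>a\<close>, the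
        quotient \<open>a / (2 * A)\<close> has the form required by
        \<open>nn_integral_weighted_powr_ge\<close>.\<close>
      have "(h t / (4 * A)) powr q t \<le> A * (a / (2 * A)) powr q t + b"
      proof (cases "a \<le> b")
        case True
        have "b * 2 \<le> b * (4 * A)" using A b by (intro mult_left_mono) auto
        then have "h t \<le> b * (4 * A)" using \<open>h t \<le> a + b\<close> True by linarith
        then have "h t / (4 * A) \<le> b" using A by (simp add: pos_divide_le_eq)
        then have "(h t / (4 * A)) powr q t \<le> b powr q t"
          using h0[OF t] A q1[of t] by (intro powr_mono2) auto
        also have "b powr q t \<le> b"
          using powr_mono'[OF q1 b(1,2), of t] b by (cases "b = 0") simp_all
        finally show ?thesis using A by (simp add: add_increasing)
      next
        case False
        then have "h t / (4 * A) \<le> a / (2 * A)"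
          using \<open>h t \<le> a + b\<close> A by (simp add: field_simps)
        then have "(h t / (4 * A)) powr q t \<le> (a / (2 * A)) powr q t"
          using h0[OF t] A q1[of t] by (intro powr_mono2) auto
        also have "\<dots> \<le> A * (a / (2 * A)) powr q t"
          using A mult_right_mono[of 1 A "(a / (2 * A)) powr q t"] by simp
        finally show ?thesis using b by simp
      qed
      then have "ennreal ((h t / (4 * A)) powr q t) \<le> ennreal (A * (a / (2 * A)) powr q t) + ennreal b"
        using A b by (simp add: ennreal_plus[symmetric] ennreal_leI del: ennreal_plus)
      \<comment> \<open>For fixed \<open>t\<close> the exponent \<open>q t\<close> is constant in
        \<open>s\<close>, so the Jensen-type bound applies with the weight \<open>k s t\<close>.
        Only afterwards is \<open>q t\<close> replaced by \<open>q s\<close> under the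
        integral.\<close>
      also have "ennreal (A * (a / (2 * A)) powr q t) \<le> (\<integral>\<^sup>+s. ennreal (k s t * g1 s powr q t) \<partial>dt_over_t)"
        by (rule nn_integral_weighted_powr_ge)
          (use kernel_mass(1)[OF t] k01 g1 A a q1 in \<open>auto simp: F1_def\<close>)
      also have "\<dots> \<le> (\<integral>\<^sup>+s. ennreal C * (ennreal (k s t) * G s) + ennreal (e s t) \<partial>dt_over_t)"
      proof (rule nn_integral_mono)
        fix s assume "s \<in> space dt_over_t"
        then have s: "0 < s" by simp
        have "k s t * g1 s powr q t \<le> C * (k s t * g1 s powr q s) + e s t"
          using kernel_exponent_exchange[OF osc q1 c less_imp_le[OF r] s t g1[OF s]]
          by (simp add: k_def C_def e_def r_def)
        also have "\<dots> \<le> C * (k s t * g s powr q s) + e s t"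
          using g1q[OF s] C k01 by (intro add_right_mono mult_left_mono) auto
        finally have "k s t * g1 s powr q t \<le> C * (k s t * g s powr q s) + e s t" .
        then have "ennreal (k s t * g1 s powr q t) \<le> ennreal (C * (k s t * g s powr q s) + e s t)"
          by (rule ennreal_leI)
        also have "\<dots> = ennreal C * (ennreal (k s t) * G s) + ennreal (e s t)"
          using C k01 unfolding G_def
          by (simp add: ennreal_mult e_def)
        finally show "ennreal (k s t * g1 s powr q t) \<le> ennreal C * (ennreal (k s t) * G s) + ennreal (e s t)" .
      qed
      also have "\<dots> = ennreal C * (\<integral>\<^sup>+s. ennreal (k s t) * G s \<partial>dt_over_t) + (\<integral>\<^sup>+s. ennreal (e s t) \<partial>dt_over_t)"
        by (subst nn_integral_add) (auto simp: nn_integral_cmult)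
      also have "ennreal b \<le> (\<integral>\<^sup>+s. ennreal (k s t) * G s \<partial>dt_over_t)"
        using F2G b by simp
      finally show ?thesis
        using C by (simp add: ennreal_plus distrib_right add_ac add_left_mono)
    qed
    have meas_kG: "(\<lambda>x. ennreal (k (fst x) (snd x)) * G (fst x)) \<in> borel_measurable (dt_over_t \<Otimes>\<^sub>M dt_over_t)"
        "(\<lambda>x. ennreal (e (fst x) (snd x))) \<in> borel_measurable (dt_over_t \<Otimes>\<^sub>M dt_over_t)"
      unfolding k_def e_def by measurable
    \<comment> \<open>Integrating in \<open>t\<close> first leaves the mass of the kernel, bounded
      by \<open>A\<close> uniformly in \<open>s\<close>, times the modular of
      \<open>g\<close>.\<close>
    have "(\<integral>\<^sup>+t. \<integral>\<^sup>+s. ennreal (k s t) * G s \<partial>dt_over_t \<partial>dt_over_t) =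
        (\<integral>\<^sup>+s. \<integral>\<^sup>+t. ennreal (k s t) * G s \<partial>dt_over_t \<partial>dt_over_t)"
      using Fubini[OF meas_kG(1)] by simp
    also have "\<dots> \<le> (\<integral>\<^sup>+s. ennreal A * G s \<partial>dt_over_t)"
    proof (rule nn_integral_mono)
      fix s assume "s \<in> space dt_over_t"
      have "(\<integral>\<^sup>+t. ennreal (k s t) * G s \<partial>dt_over_t) = (\<integral>\<^sup>+t. ennreal (k s t) \<partial>dt_over_t) * G s"
        unfolding k_def by (rule nn_integral_multc) measurable
      also have "\<dots> \<le> ennreal A * G s"
        using kernel_mass(2)[of s] \<open>s \<in> space dt_over_t\<close> by (intro mult_right_mono) auto
      finally show "(\<integral>\<^sup>+t. ennreal (k s t) * G s \<partial>dt_over_t) \<le> ennreal A * G s" .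
    qed
    also have "\<dots> = ennreal A * (\<integral>\<^sup>+s. G s \<partial>dt_over_t)"
      by (rule nn_integral_cmult) measurable
    also have "\<dots> \<le> ennreal A * 1"
      using modular unfolding G_def by (intro mult_left_mono) auto
    finally have kG: "(\<integral>\<^sup>+t. \<integral>\<^sup>+s. ennreal (k s t) * G s \<partial>dt_over_t \<partial>dt_over_t) \<le> ennreal A" by simp
    have inner[measurable]: "(\<lambda>t. \<integral>\<^sup>+s. ennreal (k s t) * G s \<partial>dt_over_t) \<in> borel_measurable dt_over_t"
        "(\<lambda>t. \<integral>\<^sup>+s. ennreal (e s t) \<partial>dt_over_t) \<in> borel_measurable dt_over_t"
      unfolding k_def e_def by measurable
    have "(\<integral>\<^sup>+t. ennreal ((h t / (4 * A * B)) powr q t) \<partial>dt_over_t) \<le>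
      (\<integral>\<^sup>+t. ennreal (1 / B) * (ennreal (C + 1) * (\<integral>\<^sup>+s. ennreal (k s t) * G s \<partial>dt_over_t) +
        (\<integral>\<^sup>+s. ennreal (e s t) \<partial>dt_over_t)) \<partial>dt_over_t)"
    proof (rule nn_integral_mono)
      fix t assume "t \<in> space dt_over_t"
      then have t: "0 < t" by simp
      have "(h t / (4 * A * B)) powr q t = (1 / B) powr q t * (h t / (4 * A)) powr q t"
        using powr_mult[of "1 / B" "h t / (4 * A)" "q t"] h0[OF t] A B by (simp add: mult_ac)
      \<comment> \<open>As \<open>B \<ge> 1\<close> and \<open>q t \<ge> 1\<close>, shrinking the
        function by \<open>B\<close> shrinks its modular at least by \<open>B\<close>.\<close>
      also have "(1 / B) powr q t \<le> (1 / B) powr 1"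
        using B by (intro powr_mono' q1) auto
      also have "(1 / B) powr 1 = 1 / B" using B by simp
      finally have "(h t / (4 * A * B)) powr q t \<le> 1 / B * (h t / (4 * A)) powr q t"
        by (simp add: mult_right_mono)
      then have "ennreal ((h t / (4 * A * B)) powr q t) \<le> ennreal (1 / B) * ennreal ((h t / (4 * A)) powr q t)"
        using B by (simp add: ennreal_mult[symmetric] ennreal_leI)
      also have "\<dots> \<le> ennreal (1 / B) * (ennreal (C + 1) * (\<integral>\<^sup>+s. ennreal (k s t) * G s \<partial>dt_over_t) +
        (\<integral>\<^sup>+s. ennreal (e s t) \<partial>dt_over_t))"
        using pointwise[OF t] by (rule mult_left_mono) simp
      finally show "ennreal ((h t / (4 * A * B)) powr q t) \<le> \<dots>" .
    qed
    also have "\<dots> = ennreal (1 / B) *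
        (ennreal (C + 1) * (\<integral>\<^sup>+t. \<integral>\<^sup>+s. ennreal (k s t) * G s \<partial>dt_over_t \<partial>dt_over_t) +
          (\<integral>\<^sup>+t. \<integral>\<^sup>+s. ennreal (e s t) \<partial>dt_over_t \<partial>dt_over_t))"
      by (simp add: nn_integral_cmult nn_integral_add)
    also have "\<dots> \<le> ennreal (1 / B) * (ennreal (C + 1) * ennreal A + ennreal ((2 / r) * (2 / r)))"
      by (intro mult_left_mono add_mono kG e_mass) auto
    also have "\<dots> = ennreal (1 / B) * ennreal B"
      using A C r unfolding B_def by (simp add: ennreal_mult[symmetric] ennreal_plus[symmetric] del: ennreal_plus)
    also have "\<dots> = 1" using B by (simp add: ennreal_mult[symmetric])
    finally show "(\<integral>\<^sup>+t. ennreal ((h t / (4 * A * B)) powr q t) \<partial>dt_over_t) \<le> 1" .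
  qed
qed

section \<open>From modulars to Luxemburg norms\<close>

lemma luxemburg_norm_le:
  assumes B: "0 < B"
    and imp: "\<And>l. 0 < l \<Longrightarrow> (\<integral>\<^sup>+t. ennreal (\<bar>g t / l\<bar> powr q t) \<partial>dt_over_t) \<le> 1 \<Longrightarrow>
      (\<integral>\<^sup>+t. ennreal (\<bar>h t / (B * l)\<bar> powr q t) \<partial>dt_over_t) \<le> 1"
  shows "luxemburg_norm q h \<le> ennreal B * luxemburg_norm q g"
proof -
  \<comment> \<open>With \<open>B\<close> moved to the left the right-hand side is a bare infimum,
    and the case without an admissible \<open>l\<close> needs no separate treatment.\<close>
  have "ennreal (1 / B) * luxemburg_norm q h \<le> luxemburg_norm q g"
    unfolding luxemburg_norm_def[of q g]
  proof (rule Inf_greatest, clarify)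
    fix l assume l: "0 < l" "(\<integral>\<^sup>+t. ennreal (\<bar>g t / l\<bar> powr q t) \<partial>dt_over_t) \<le> 1"
    have "luxemburg_norm q h \<le> ennreal (B * l)"
      unfolding luxemburg_norm_def using imp[OF l] l(1) B by (intro Inf_lower) auto
    then have "ennreal (1 / B) * luxemburg_norm q h \<le> ennreal (1 / B) * ennreal (B * l)"
      by (rule mult_left_mono) simp
    also have "\<dots> = ennreal l"
      using B l(1) by (simp add: ennreal_mult[symmetric])
    finally show "ennreal (1 / B) * luxemburg_norm q h \<le> ennreal l" .
  qed
  then have "ennreal B * (ennreal (1 / B) * luxemburg_norm q h) \<le> ennreal B * luxemburg_norm q g"
    by (rule mult_left_mono) simp
  moreover have "ennreal B * ennreal (1 / B) = 1"
    using B by (simp add: ennreal_mult[symmetric])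
  ultimately show ?thesis by (simp add: mult.assoc[symmetric])
qed

lemma luxemburg_norm_mono:
  assumes B: "0 < B" and q: "\<And>t. 0 < t \<Longrightarrow> 0 \<le> q t"
    and le: "\<And>t. 0 < t \<Longrightarrow> \<bar>h t\<bar> \<le> B * \<bar>g t\<bar>"
  shows "luxemburg_norm q h \<le> ennreal B * luxemburg_norm q g"
proof (rule luxemburg_norm_le[OF B])
  fix l :: real
  assume l: "0 < l" and g: "(\<integral>\<^sup>+t. ennreal (\<bar>g t / l\<bar> powr q t) \<partial>dt_over_t) \<le> 1"
  have "(\<integral>\<^sup>+t. ennreal (\<bar>h t / (B * l)\<bar> powr q t) \<partial>dt_over_t) \<le>
      (\<integral>\<^sup>+t. ennreal (\<bar>g t / l\<bar> powr q t) \<partial>dt_over_t)"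
  proof (intro nn_integral_mono ennreal_leI powr_mono2)
    fix t assume "t \<in> space dt_over_t"
    then have t: "0 < t" by simp
    show "0 \<le> q t" by (rule q[OF t])
    have "\<bar>h t / (B * l)\<bar> = \<bar>h t\<bar> / (B * l)" using B l by (simp add: abs_mult)
    also have "\<dots> \<le> (B * \<bar>g t\<bar>) / (B * l)"
      using le[OF t] B l by (intro divide_right_mono) auto
    also have "\<dots> = \<bar>g t / l\<bar>" using B l by simp
    finally show "\<bar>h t / (B * l)\<bar> \<le> \<bar>g t / l\<bar>" .
  qed simp
  then show "(\<integral>\<^sup>+t. ennreal (\<bar>h t / (B * l)\<bar> powr q t) \<partial>dt_over_t) \<le> 1"
    using g by (rule order_trans)
qed

text \<open>With \<open>x = ln t - ln s\<close>, the logarithm of \<open>min 1 (t / s)\<close> minus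
  \<open>\<theta> * x\<close> is \<open>- \<theta> * x\<close> for \<open>x \<ge> 0\<close> and
  \<open>(1 - \<theta>) * x\<close> for \<open>x \<le> 0\<close>. Both lie below
  \<open>- d * \<bar>x\<bar>\<close> as \<open>d\<close> is at most either slope.\<close>

lemma min_le_log_kernel:
  fixes s t d \<theta> :: real
  assumes "0 < s" "0 < t" "d \<le> \<theta>" "d \<le> 1 - \<theta>"
  shows "min 1 (t / s) \<le> t powr \<theta> * s powr - \<theta> * exp (- d * \<bar>ln s - ln t\<bar>)"
proof -
  have rhs: "t powr \<theta> * s powr - \<theta> * exp (- d * \<bar>ln s - ln t\<bar>) =
      exp (\<theta> * (ln t - ln s) - d * \<bar>ln s - ln t\<bar>)"
    using assms by (simp add: powr_def exp_add[symmetric] algebra_simps)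
  show ?thesis
  proof (cases "ln s \<le> ln t")
    case True
    have "d * (ln t - ln s) \<le> \<theta> * (ln t - ln s)"
      using True assms by (intro mult_right_mono) auto
    then have "0 \<le> \<theta> * (ln t - ln s) - d * \<bar>ln s - ln t\<bar>" using True by simp
    then show ?thesis unfolding rhs by (intro min.coboundedI1) simp
  next
    case False
    have "d * (ln s - ln t) \<le> (1 - \<theta>) * (ln s - ln t)"
      using False assms by (intro mult_right_mono) auto
    then have "ln t - ln s \<le> \<theta> * (ln t - ln s) - d * \<bar>ln s - ln t\<bar>"
      using False by (simp add: algebra_simps)
    moreover have "t / s = exp (ln t - ln s)" using assms by (simp add: exp_diff)
    ultimately show ?thesis unfolding rhs by (intro min.coboundedI2) simp
  qed
qed

section \<open>Compatible couples\<close>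

locale couple =
  fixes i\<^sub>0 :: "'a::banach \<Rightarrow> 'v::{real_vector, topological_ab_group_add, t2_space}"
    and i\<^sub>1 :: "'b::banach \<Rightarrow> 'v"
  assumes compatible: "compatible_couple i\<^sub>0 i\<^sub>1"
begin

lemma linear0: "linear i\<^sub>0" and linear1: "linear i\<^sub>1"
  and inj0: "inj i\<^sub>0" and inj1: "inj i\<^sub>1"
  and continuous0: "continuous_on UNIV i\<^sub>0" and continuous1: "continuous_on UNIV i\<^sub>1"
  using compatible by (auto simp: compatible_couple_def)

lemma inv0 [simp]: "inv i\<^sub>0 (i\<^sub>0 a) = a" and inv1 [simp]: "inv i\<^sub>1 (i\<^sub>1 b) = b"
  using inj0 inj1 by simp_all

abbreviation "K \<equiv> K_functional i\<^sub>0 i\<^sub>1"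
abbreviation "J \<equiv> J_functional i\<^sub>0 i\<^sub>1"
abbreviation "S \<equiv> sum_space i\<^sub>0 i\<^sub>1"
abbreviation "D \<equiv> inter_space i\<^sub>0 i\<^sub>1"

lemma subspace_sum_space: "subspace S"
proof (rule subspaceI)
  show "0 \<in> S"
    unfolding sum_space_def using linear_0[OF linear0] linear_0[OF linear1]
    by (auto intro!: exI[of _ 0])
next
  fix x y assume "x \<in> S" "y \<in> S"
  then obtain a b a' b' where "x = i\<^sub>0 a + i\<^sub>1 b" "y = i\<^sub>0 a' + i\<^sub>1 b'"
    unfolding sum_space_def by auto
  then have "x + y = i\<^sub>0 (a + a') + i\<^sub>1 (b + b')"
    by (simp add: linear_add[OF linear0] linear_add[OF linear1])
  then show "x + y \<in> S" unfolding sum_space_def by blast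
next
  fix c :: real and x assume "x \<in> S"
  then obtain a b where "x = i\<^sub>0 a + i\<^sub>1 b" unfolding sum_space_def by auto
  then have "c *\<^sub>R x = i\<^sub>0 (c *\<^sub>R a) + i\<^sub>1 (c *\<^sub>R b)"
    by (simp add: linear_scale[OF linear0] linear_scale[OF linear1] scaleR_add_right)
  then show "c *\<^sub>R x \<in> S" unfolding sum_space_def by blast
qed

lemma subspace_inter_space: "subspace D"
  unfolding inter_space_def
  by (intro subspace_inter linear_subspace_image linear0 linear1 subspace_UNIV)

lemma inter_subset_sum: "x \<in> D \<Longrightarrow> x \<in> S"
proof -
  assume "x \<in> D"
  then obtain a where "x = i\<^sub>0 a + i\<^sub>1 0"
    using linear_0[OF linear1] unfolding inter_space_def by auto
  then show "x \<in> S" unfolding sum_space_def by blast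
qed

section \<open>The K-functional as a family of equivalent norms on the sum\<close>

lemma K_le:
  assumes "0 \<le> t" "f = i\<^sub>0 a + i\<^sub>1 b"
  shows "K t f \<le> norm a + t * norm b"
  unfolding K_functional_def
  by (rule cInf_lower) (use assms in \<open>auto intro!: bdd_belowI[of _ 0]\<close>)

lemma K_greatest:
  assumes "f \<in> S" "\<And>a b. f = i\<^sub>0 a + i\<^sub>1 b \<Longrightarrow> z \<le> norm a + t * norm b"
  shows "z \<le> K t f"
  unfolding K_functional_def
  by (rule cInf_greatest) (use assms in \<open>auto simp: sum_space_def\<close>)

lemma K_nonneg:
  assumes "0 \<le> t" "f \<in> S"
  shows "0 \<le> K t f"
  by (rule K_greatest) (use assms in auto)

lemma K_decomposition:
  assumes "f \<in> S" "K t f < z"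
  obtains a b where "f = i\<^sub>0 a + i\<^sub>1 b" "norm a + t * norm b < z"
proof -
  have "\<exists>a b. f = i\<^sub>0 a + i\<^sub>1 b \<and> norm a + t * norm b < z"
    using K_greatest[OF assms(1), of z t] assms(2) by (meson not_le)
  then show ?thesis using that by blast
qed

lemma K_add:
  assumes "0 \<le> t" "f \<in> S" "g \<in> S"
  shows "K t (f + g) \<le> K t f + K t g"
proof (rule field_le_epsilon)
  fix e :: real assume "0 < e"
  obtain a b where 1: "f = i\<^sub>0 a + i\<^sub>1 b" "norm a + t * norm b < K t f + e / 2"
    using K_decomposition[OF assms(2), of t "K t f + e / 2"] \<open>0 < e\<close> by auto
  obtain a' b' where 2: "g = i\<^sub>0 a' + i\<^sub>1 b'" "norm a' + t * norm b' < K t g + e / 2"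
    using K_decomposition[OF assms(3), of t "K t g + e / 2"] \<open>0 < e\<close> by auto
  have "f + g = i\<^sub>0 (a + a') + i\<^sub>1 (b + b')"
    using 1 2 by (simp add: linear_add[OF linear0] linear_add[OF linear1])
  then have "K t (f + g) \<le> norm (a + a') + t * norm (b + b')"
    by (rule K_le[OF assms(1)])
  also have "\<dots> \<le> (norm a + norm a') + t * (norm b + norm b')"
    by (intro add_mono mult_left_mono norm_triangle_ineq assms(1))
  finally show "K t (f + g) \<le> K t f + K t g + e"
    using 1(2) 2(2) by (simp add: algebra_simps)
qed

lemma K_scaleR:
  assumes "0 \<le> t" "f \<in> S"
  shows "K t (c *\<^sub>R f) \<le> \<bar>c\<bar> * K t f"
proof (cases "c = 0")
  case True
  then show ?thesis
    using K_le[of t 0 0 0] assms linear_0[OF linear0] linear_0[OF linear1] by simp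
next
  case False
  have "K t (c *\<^sub>R f) / \<bar>c\<bar> \<le> K t f"
  proof (rule K_greatest[OF assms(2)])
    fix a b assume "f = i\<^sub>0 a + i\<^sub>1 b"
    then have "c *\<^sub>R f = i\<^sub>0 (c *\<^sub>R a) + i\<^sub>1 (c *\<^sub>R b)"
      by (simp add: linear_scale[OF linear0] linear_scale[OF linear1] scaleR_add_right)
    then have "K t (c *\<^sub>R f) \<le> norm (c *\<^sub>R a) + t * norm (c *\<^sub>R b)"
      by (rule K_le[OF assms(1)])
    then show "K t (c *\<^sub>R f) / \<bar>c\<bar> \<le> norm a + t * norm b"
      using False by (simp add: field_simps)
  qed
  then show ?thesis using False by (simp add: field_simps)
qed

lemma K_zero: "0 \<le> t \<Longrightarrow> K t 0 = 0"
  using K_scaleR[of t 0 0] K_nonneg[of t 0] subspace_0[OF subspace_sum_space] by simp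

lemma K_minus:
  assumes "0 \<le> t" "f \<in> S"
  shows "K t (- f) = K t f"
  using K_scaleR[OF assms, of "-1"] K_scaleR[of t "- f" "-1"] assms
    subspace_neg[OF subspace_sum_space] by force

text \<open>With \<open>K_le_sum_norm\<close> this makes \<open>K t\<close> Lipschitz for the norm
  of the sum, which is what measurability and passage to the limit require.\<close>

lemma K_diff:
  assumes "0 \<le> t" "f \<in> S" "g \<in> S"
  shows "\<bar>K t f - K t g\<bar> \<le> K t (f - g)"
proof -
  have "f - g \<in> S" "g - f \<in> S"
    using assms subspace_diff[OF subspace_sum_space] by auto
  then show ?thesis
    using K_add[of t "f - g" g] K_add[of t "g - f" f] K_minus[of t "f - g"] assms by auto
qed

lemma K_sum:
  assumes "0 \<le> t" "\<And>x. x \<in> A \<Longrightarrow> g x \<in> S"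
  shows "K t (sum g A) \<le> (\<Sum>x\<in>A. K t (g x))"
  using assms
proof (induction A rule: infinite_finite_induct)
  case (insert x F)
  then have "K t (g x + sum g F) \<le> K t (g x) + K t (sum g F)"
    by (intro K_add subspace_sum[OF subspace_sum_space]) auto
  then show ?case using insert by force
qed (auto simp: K_zero)

lemma K_mono:
  assumes "0 \<le> s" "s \<le> t" "f \<in> S"
  shows "K s f \<le> K t f"
proof (rule K_greatest[OF assms(3)])
  fix a b assume "f = i\<^sub>0 a + i\<^sub>1 b"
  then have "K s f \<le> norm a + s * norm b" by (rule K_le[OF assms(1)])
  also have "\<dots> \<le> norm a + t * norm b"
    using assms by (simp add: mult_right_mono)
  finally show "K s f \<le> norm a + t * norm b" .
qed

text \<open>Multiplying the cost of a decomposition at \<open>t\<close> by \<open>s / t\<close>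
  turns the weight of the second summand into \<open>s\<close> and can only shrink the first.
  Together with \<open>K_mono\<close> it keeps \<open>K\<close> within a factor \<open>2\<close>
  between neighbouring dyadic points.\<close>

lemma K_quotient_antimono:
  assumes "0 < s" "s \<le> t" "f \<in> S"
  shows "K t f \<le> t / s * K s f"
proof -
  have "s / t * K t f \<le> K s f"
  proof (rule K_greatest[OF assms(3)])
    fix a b assume "f = i\<^sub>0 a + i\<^sub>1 b"
    then have "K t f \<le> norm a + t * norm b" by (intro K_le) (use assms in auto)
    then have "s / t * K t f \<le> s / t * (norm a + t * norm b)"
      by (rule mult_left_mono) (use assms in auto)
    also have "\<dots> = s / t * norm a + s * norm b"
      using assms by (simp add: field_simps)
    also have "s / t * norm a \<le> 1 * norm a"
      using assms by (intro mult_right_mono) auto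
    finally show "s / t * K t f \<le> norm a + s * norm b" by simp
  qed
  then show ?thesis using assms by (simp add: field_simps)
qed

lemma sum_norm_eq_K: "sum_norm i\<^sub>0 i\<^sub>1 f = K 1 f"
  unfolding sum_norm_def K_functional_def by simp

lemma K_le_sum_norm:
  assumes "0 < t" "f \<in> S"
  shows "K t f \<le> max 1 t * sum_norm i\<^sub>0 i\<^sub>1 f"
  using K_mono[of t 1 f] K_quotient_antimono[of 1 t f] assms
  by (auto simp: sum_norm_eq_K max_def)

text \<open>An element of the intersection has the two trivial decompositions with one summand
  \<open>0\<close>; each gives one half of the minimum.\<close>

lemma K_le_J:
  assumes "0 < s" "0 < t" "f \<in> D"
  shows "K t f \<le> min 1 (t / s) * J s f"
proof -
  obtain a b where f: "f = i\<^sub>0 a" "f = i\<^sub>1 b"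
    using assms(3) unfolding inter_space_def by blast
  have J: "J s f = max (norm a) (s * norm b)"
    unfolding J_functional_def by (metis f inv0 inv1)
  have "K t f \<le> norm a"
    using K_le[of t f a 0] f assms linear_0[OF linear1] by simp
  moreover have "K t f \<le> t * norm b"
    using K_le[of t f 0 b] f assms linear_0[OF linear0] by simp
  moreover have "t / s * (s * norm b) \<le> t / s * J s f"
    unfolding J using assms by (intro mult_left_mono) auto
  moreover have "norm a \<le> J s f" unfolding J by simp
  ultimately have "K t f \<le> 1 * J s f" "K t f \<le> t / s * J s f"
    using assms by simp_all
  then show ?thesis by (cases "1 \<le> t / s") (simp_all add: min_def)
qed

text \<open>This is where the Hausdorff property of the ambient space enters.\<close>

lemma K_eq_0_imp:
  assumes "0 < t" "f \<in> S" "K t f = 0"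
  shows "f = 0"
proof -
  \<comment> \<open>The infimum \<open>0\<close> is not known to be attained, so a sequence of
    decompositions with both parts tending to \<open>0\<close> is used. Continuity of the embeddings
    then makes the constant sequence \<open>f\<close> tend to \<open>0\<close>.\<close>
  have "\<exists>a b. f = i\<^sub>0 a + i\<^sub>1 b \<and> norm a + t * norm b < inverse (real (Suc n))" for n
  proof -
    have "K t f < inverse (real (Suc n))" using assms(3) by simp
    from K_decomposition[OF assms(2) this] show ?thesis by blast
  qed
  then obtain a b where ab: "\<And>n. f = i\<^sub>0 (a n) + i\<^sub>1 (b n)"
      and ab': "\<And>n. norm (a n) + t * norm (b n) < inverse (real (Suc n))"
    by metis
  have a: "a \<longlonglongrightarrow> 0"
  proof (rule Lim_null_comparison)
    show "\<forall>\<^sub>F n in sequentially. norm (a n) \<le> inverse (real (Suc n))"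
    proof (intro always_eventually allI)
      fix n
      have "0 \<le> t * norm (b n)" using assms(1) by simp
      then show "norm (a n) \<le> inverse (real (Suc n))" using ab'[of n] by linarith
    qed
  qed (rule LIMSEQ_inverse_real_of_nat)
  have b: "b \<longlonglongrightarrow> 0"
  proof (rule Lim_null_comparison)
    have "t * norm (b n) \<le> inverse (real (Suc n))" for n
      using ab'[of n] norm_ge_zero[of "a n"] by linarith
    then have "norm (b n) \<le> inverse t * inverse (real (Suc n))" for n
      using assms(1) pos_le_divide_eq[of t "norm (b n)" "inverse (real (Suc n))"]
      by (metis divide_inverse mult.commute)
    then show "\<forall>\<^sub>F n in sequentially. norm (b n) \<le> inverse t * inverse (real (Suc n))"
      by (intro always_eventually allI)
    show "(\<lambda>n. inverse t * inverse (real (Suc n))) \<longlonglongrightarrow> 0"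
      using tendsto_mult_left[OF LIMSEQ_inverse_real_of_nat, of "inverse t"] by simp
  qed
  have cont: "isCont i\<^sub>0 0" "isCont i\<^sub>1 0"
    using continuous0 continuous1 by (simp_all add: continuous_on_eq_continuous_at)
  have "(\<lambda>n. i\<^sub>0 (a n) + i\<^sub>1 (b n)) \<longlonglongrightarrow> i\<^sub>0 0 + i\<^sub>1 0"
    by (rule tendsto_add[OF isCont_tendsto_compose[OF cont(1) a] isCont_tendsto_compose[OF cont(2) b]])
  then have "(\<lambda>n. f) \<longlonglongrightarrow> 0"
    by (simp only: ab(1)[symmetric] linear_0[OF linear0] linear_0[OF linear1] add_0)
  from LIMSEQ_unique[OF tendsto_const this] show ?thesis .
qed

end

text \<open>Since \<open>p\<close> is Lipschitz for \<open>N\<close>, the composition with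
  \<open>u\<close> is almost everywhere the limit of the simple functions \<open>p (s n x)\<close>.
  As \<open>M\<close> is not assumed complete, the conclusion is equality almost everywhere with a
  measurable function.\<close>

lemma strongly_measurable_imp_AE_measurable:
  fixes p :: "'v::real_vector \<Rightarrow> real"
  assumes u: "strongly_measurable M A N u"
    and p: "\<And>x y. x \<in> A \<Longrightarrow> y \<in> A \<Longrightarrow> \<bar>p x - p y\<bar> \<le> C * N (x - y)"
  obtains h where "h \<in> borel_measurable M" "AE x in M. p (u x) = h x"
proof -
  obtain s where s: "\<And>n. simple_function M (s n)" "\<And>n x. x \<in> space M \<Longrightarrow> s n x \<in> A"
      "AE x in M. (\<lambda>n. N (u x - s n x)) \<longlonglongrightarrow> 0" "\<And>x. x \<in> space M \<Longrightarrow> u x \<in> A"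
    using u unfolding strongly_measurable_def by blast
  have "(\<lambda>x. p (s n x)) \<in> borel_measurable M" for n
    using borel_measurable_simple_function[OF simple_function_compose1[OF s(1)]] .
  then have "(\<lambda>x. lim (\<lambda>n. p (s n x))) \<in> borel_measurable M"
    by measurable
  moreover have "AE x in M. p (u x) = lim (\<lambda>n. p (s n x))"
    using s(3) AE_space
  proof eventually_elim
    case (elim x)
    have True: "x \<in> space M" by fact
      have "(\<lambda>n. C * N (u x - s n x)) \<longlonglongrightarrow> 0"
        using tendsto_mult_left[OF elim(1), of C] by simp
      then have "(\<lambda>n. p (u x) - p (s n x)) \<longlonglongrightarrow> 0"
        by (rule Lim_null_comparison[rotated])
          (use p s(2,4) True in \<open>auto intro!: always_eventually\<close>)
      then have "(\<lambda>n. p (u x) - (p (u x) - p (s n x))) \<longlonglongrightarrow> p (u x) - 0"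
        by (intro tendsto_diff tendsto_const)
      then show ?case by (simp add: limI)
  qed
  ultimately show ?thesis using that by blast
qed

section \<open>The K-functional of a Bochner integral\<close>

context couple
begin

lemma K_simple_bochner_integral_le:
  assumes s: "Bochner_Integration.simple_bochner_integrable M s"
    and S: "\<And>x. x \<in> space M \<Longrightarrow> s x \<in> S" and t: "0 \<le> t"
  shows "ennreal (K t (Bochner_Integration.simple_bochner_integral M s)) \<le>
    (\<integral>\<^sup>+x. ennreal (K t (s x)) \<partial>M)"
proof -
  \<comment> \<open>Outside the sum \<open>K t\<close> is an infimum over the empty set. Truncation
    makes \<open>v\<close> nonnegative everywhere without changing the values that occur.\<close>
  define v where "v y = max 0 (K t y)" for y
  have s': "simple_function M s"
    using s by (auto simp: Bochner_Integration.simple_bochner_integrable.simps)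
  have v0: "v 0 = 0" using K_zero[OF t] by (simp add: v_def)
  have vs: "Bochner_Integration.simple_bochner_integrable M (\<lambda>x. v (s x))"
    using simple_bochner_integrable_compose2[of "\<lambda>x y. v x" M s s] v0 s by simp
  have "K t (Bochner_Integration.simple_bochner_integral M s)
      \<le> (\<Sum>y\<in>s ` space M. K t (measure M {x\<in>space M. s x = y} *\<^sub>R y))"
    unfolding Bochner_Integration.simple_bochner_integral_def
    using S by (intro K_sum t) (auto intro: subspace_scale[OF subspace_sum_space])
  also have "\<dots> \<le> (\<Sum>y\<in>s ` space M. measure M {x\<in>space M. s x = y} *\<^sub>R v y)"
  proof (rule sum_mono)
    fix y assume "y \<in> s ` space M"
    then have "y \<in> S" using S by auto
    then show "K t (measure M {x\<in>space M. s x = y} *\<^sub>R y) \<le> measure M {x\<in>space M. s x = y} *\<^sub>R v y"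
      using K_scaleR[OF t, of y "measure M {x\<in>space M. s x = y}"] K_nonneg[OF t, of y]
      by (simp add: v_def)
  qed
  also have "\<dots> = Bochner_Integration.simple_bochner_integral M (\<lambda>x. v (s x))"
    by (rule simple_bochner_integral_partition[OF vs s', symmetric]) auto
  finally have "ennreal (K t (Bochner_Integration.simple_bochner_integral M s)) \<le>
      ennreal (Bochner_Integration.simple_bochner_integral M (\<lambda>x. v (s x)))"
    by (rule ennreal_leI)
  also have "\<dots> = (\<integral>\<^sup>+x. ennreal (v (s x)) \<partial>M)"
    by (rule simple_bochner_integral_eq_nn_integral[OF vs]) (simp add: v_def)
  also have "\<dots> = (\<integral>\<^sup>+x. ennreal (K t (s x)) \<partial>M)"
    by (intro nn_integral_cong) (use S K_nonneg[OF t] in \<open>auto simp: v_def max_def\<close>)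
  finally show ?thesis .
qed

lemma simple_bochner_integral_in_sum_space:
  assumes "\<And>x. x \<in> space M \<Longrightarrow> s x \<in> S"
  shows "Bochner_Integration.simple_bochner_integral M s \<in> S"
  unfolding Bochner_Integration.simple_bochner_integral_def
  using assms by (auto intro!: subspace_sum[OF subspace_sum_space] subspace_scale[OF subspace_sum_space])

text \<open>Minkowski's integral inequality for \<open>K t\<close>: it holds for simple functions by
  sublinearity, and both approximation errors are at most \<open>max 1 t\<close> times errors in the
  norm of the sum, which tend to \<open>0\<close>.\<close>

lemma K_has_Bochner_integral_le:
  assumes u: "has_Bochner_integral_wrt M S (sum_norm i\<^sub>0 i\<^sub>1) u f" and t: "0 < t"
  shows "ennreal (K t f) \<le> (\<integral>\<^sup>+x. ennreal (K t (u x)) \<partial>M)"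
proof -
  define c where "c = max 1 t"
  define N where "N = sum_norm i\<^sub>0 i\<^sub>1"
  have c: "0 < c" by (simp add: c_def)
  have N0: "0 \<le> N x" if "x \<in> S" for x
    using K_nonneg[of 1 x] that by (simp add: N_def sum_norm_eq_K)
  have KN: "\<bar>K t x - K t y\<bar> \<le> c * N (x - y)" if "x \<in> S" "y \<in> S" for x y
    using order_trans[OF K_diff[OF less_imp_le[OF t] that]
      K_le_sum_norm[OF t subspace_diff[OF subspace_sum_space that]]] by (simp add: c_def N_def)
  have sm: "strongly_measurable M S N u" and f: "f \<in> S"
    using u by (auto simp: has_Bochner_integral_wrt_def N_def)
  have uS: "u x \<in> S" if "x \<in> space M" for x
    using sm that by (auto simp: strongly_measurable_def)
  obtain s where s: "\<And>n. Bochner_Integration.simple_bochner_integrable M (s n)"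
      "\<And>n x. x \<in> space M \<Longrightarrow> s n x \<in> S"
      "(\<lambda>n. \<integral>\<^sup>+x. ennreal (N (u x - s n x)) \<partial>M) \<longlonglongrightarrow> 0"
      "(\<lambda>n. N (Bochner_Integration.simple_bochner_integral M (s n) - f)) \<longlonglongrightarrow> 0"
    using u unfolding has_Bochner_integral_wrt_def N_def by blast
  obtain h where h[measurable]: "h \<in> borel_measurable M" and hu: "AE x in M. K t (u x) = h x"
    using strongly_measurable_imp_AE_measurable[OF sm KN] by blast
  define I where "I n = Bochner_Integration.simple_bochner_integral M (s n)" for n
  have IS: "I n \<in> S" for n
    unfolding I_def by (rule simple_bochner_integral_in_sum_space) (rule s(2))
  have bound: "ennreal (K t f) \<le> ennreal (c * N (I n - f)) +
      ((\<integral>\<^sup>+x. ennreal (h x) \<partial>M) + ennreal c * (\<integral>\<^sup>+x. ennreal (N (u x - s n x)) \<partial>M))" for n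
  proof -
    have [measurable]: "(\<lambda>x. K t (s n x)) \<in> borel_measurable M"
      by (rule borel_measurable_simple_function, rule simple_function_compose1)
        (use s(1)[of n] in \<open>auto simp: Bochner_Integration.simple_bochner_integrable.simps\<close>)
    \<comment> \<open>The function \<open>N (u x - s n x)\<close> is not known to be measurable, so
      its integral cannot be split off by additivity. The measurable \<open>w\<close> takes its
      place and is compared with it by monotonicity alone.\<close>
    define w where "w x = max 0 (K t (s n x) - h x) / c" for x
    have [measurable]: "w \<in> borel_measurable M" unfolding w_def by measurable
    have "K t f \<le> c * N (I n - f) + K t (I n)"
      using KN[OF IS f, of n] by auto
    then have "ennreal (K t f) \<le> ennreal (c * N (I n - f) + K t (I n))"
      by (rule ennreal_leI)
    also have "\<dots> = ennreal (c * N (I n - f)) + ennreal (K t (I n))"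
      using c N0[of "I n - f"] IS f K_nonneg[of t "I n"] t subspace_diff[OF subspace_sum_space]
      by (intro ennreal_plus) auto
    also have "ennreal (K t (I n)) \<le> (\<integral>\<^sup>+x. ennreal (K t (s n x)) \<partial>M)"
      unfolding I_def by (intro K_simple_bochner_integral_le s less_imp_le[OF t])
    also have "\<dots> \<le> (\<integral>\<^sup>+x. ennreal (h x) + ennreal c * ennreal (w x) \<partial>M)"
    proof (rule nn_integral_mono_AE)
      show "AE x in M. ennreal (K t (s n x)) \<le> ennreal (h x) + ennreal c * ennreal (w x)"
        using hu AE_space
      proof eventually_elim
        case (elim x)
        then have "0 \<le> h x" using K_nonneg[of t "u x"] uS t by auto
        moreover have "K t (s n x) \<le> h x + c * w x" using c by (auto simp: w_def)
        moreover have "0 \<le> w x" using c by (simp add: w_def)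
        ultimately show ?case using c
          by (simp add: ennreal_mult[symmetric] ennreal_plus[symmetric] ennreal_leI del: ennreal_plus)
      qed
    qed
    also have "\<dots> = (\<integral>\<^sup>+x. ennreal (h x) \<partial>M) + ennreal c * (\<integral>\<^sup>+x. ennreal (w x) \<partial>M)"
      by (subst nn_integral_add) (auto simp: nn_integral_cmult)
    also have "(\<integral>\<^sup>+x. ennreal (w x) \<partial>M) \<le> (\<integral>\<^sup>+x. ennreal (N (u x - s n x)) \<partial>M)"
    proof (rule nn_integral_mono_AE)
      show "AE x in M. ennreal (w x) \<le> ennreal (N (u x - s n x))"
        using hu AE_space
      proof eventually_elim
        case (elim x)
        then have *: "u x \<in> S" "s n x \<in> S" using uS s(2) by auto
        then have "u x - s n x \<in> S" by (rule subspace_diff[OF subspace_sum_space])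
        then have "max 0 (K t (s n x) - h x) \<le> N (u x - s n x) * c"
          using KN[OF *] N0 c elim by (auto simp: mult.commute)
        then have "w x \<le> N (u x - s n x)"
          unfolding w_def using c by (simp only: pos_divide_le_eq)
        then show ?case by (rule ennreal_leI)
      qed
    qed
    finally show ?thesis by (simp add: add_left_mono mult_left_mono)
  qed
  have "(\<lambda>n. ennreal (c * N (I n - f)) + ((\<integral>\<^sup>+x. ennreal (h x) \<partial>M) +
      ennreal c * (\<integral>\<^sup>+x. ennreal (N (u x - s n x)) \<partial>M)))
    \<longlonglongrightarrow> ennreal (c * 0) + ((\<integral>\<^sup>+x. ennreal (h x) \<partial>M) + ennreal c * 0)"
  proof (rule tendsto_add[OF tendsto_ennrealI tendsto_add[OF tendsto_const ennreal_tendsto_cmult]])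
    show "(\<lambda>n. c * N (I n - f)) \<longlonglongrightarrow> c * 0"
      using s(4) unfolding I_def by (rule tendsto_mult_left)
  qed (use s(3) in simp_all)
  then have "ennreal (K t f) \<le> ennreal (c * 0) + ((\<integral>\<^sup>+x. ennreal (h x) \<partial>M) + ennreal c * 0)"
    by (rule LIMSEQ_le_const) (intro exI allI impI bound)
  also have "\<dots> = (\<integral>\<^sup>+x. ennreal (K t (u x)) \<partial>M)"
    using hu by (auto intro!: nn_integral_cong_AE)
  finally show ?thesis .
qed

end

section \<open>From representations to the K-functional\<close>

context couple
begin

lemma J_nonneg: "0 \<le> J t x"
  by (simp add: J_functional_def max.coboundedI1)

text \<open>\<open>J\<close> depends on \<open>t\<close> in two ways, through its weight and through
  \<open>u t\<close>. So the two component norms, each Lipschitz for the norm of the intersection,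
  are treated separately and recombined.\<close>

lemma J_representation_AE_measurable:
  assumes "strongly_measurable dt_over_t D (inter_norm i\<^sub>0 i\<^sub>1) u"
  obtains h where "h \<in> borel_measurable dt_over_t" "AE t in dt_over_t. J t (u t) = h t"
proof -
  have 0: "\<bar>norm (inv i\<^sub>0 x) - norm (inv i\<^sub>0 y)\<bar> \<le> 1 * inter_norm i\<^sub>0 i\<^sub>1 (x - y)"
    and 1: "\<bar>norm (inv i\<^sub>1 x) - norm (inv i\<^sub>1 y)\<bar> \<le> 1 * inter_norm i\<^sub>0 i\<^sub>1 (x - y)"
    if xy: "x \<in> D" "y \<in> D" for x y
  proof -
    from xy obtain a a' where a: "x = i\<^sub>0 a" "y = i\<^sub>0 a'" by (auto simp: inter_space_def)
    from xy obtain b b' where b: "x = i\<^sub>1 b" "y = i\<^sub>1 b'" unfolding inter_space_def by blast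
    have "inv i\<^sub>0 (x - y) = a - a'"
      unfolding a by (simp flip: linear_diff[OF linear0])
    moreover have "inv i\<^sub>1 (x - y) = b - b'"
      unfolding b by (simp flip: linear_diff[OF linear1])
    moreover have "inv i\<^sub>0 x = a" "inv i\<^sub>0 y = a'" unfolding a by simp_all
    moreover have "inv i\<^sub>1 x = b" "inv i\<^sub>1 y = b'" unfolding b by simp_all
    ultimately show "\<bar>norm (inv i\<^sub>0 x) - norm (inv i\<^sub>0 y)\<bar> \<le> 1 * inter_norm i\<^sub>0 i\<^sub>1 (x - y)"
      "\<bar>norm (inv i\<^sub>1 x) - norm (inv i\<^sub>1 y)\<bar> \<le> 1 * inter_norm i\<^sub>0 i\<^sub>1 (x - y)"
      by (simp_all add: inter_norm_def max.coboundedI1 max.coboundedI2 norm_triangle_ineq3)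
  qed
  obtain h0 where [measurable]: "h0 \<in> borel_measurable dt_over_t"
      and h0: "AE t in dt_over_t. norm (inv i\<^sub>0 (u t)) = h0 t"
    by (rule strongly_measurable_imp_AE_measurable[OF assms 0])
  obtain h1 where [measurable]: "h1 \<in> borel_measurable dt_over_t"
      and h1: "AE t in dt_over_t. norm (inv i\<^sub>1 (u t)) = h1 t"
    by (rule strongly_measurable_imp_AE_measurable[OF assms 1])
  have [measurable]: "(\<lambda>t. t) \<in> borel_measurable dt_over_t"
    by (rule borel_imp_borel_measurable_dt_over_t) measurable
  have "(\<lambda>t. max (h0 t) (t * h1 t)) \<in> borel_measurable dt_over_t" by measurable
  moreover have "AE t in dt_over_t. J t (u t) = max (h0 t) (t * h1 t)"
    using h0 h1 by eventually_elim (simp add: J_functional_def)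
  ultimately show ?thesis using that by blast
qed

text \<open>\<open>B\<close> comes from the convolution bound and is fixed before \<open>f\<close>
  and \<open>u\<close>; this uniformity allows the infimum over all representations to be
  taken.\<close>

lemma K_norm_le_J_representation:
  assumes \<theta>: "0 < \<theta>" "\<theta> < 1"
    and q: "q \<in> variable_exponents" "log_Hoelder_at_origin q" "log_Hoelder_at_infinity q"
  obtains B where "0 < B"
    "\<And>f u. u \<in> J_representations i\<^sub>0 i\<^sub>1 f \<Longrightarrow>
      K_norm i\<^sub>0 i\<^sub>1 \<theta> q f \<le> ennreal B * luxemburg_norm q (\<lambda>t. t powr - \<theta> * J t (u t))"
proof -
  define d where "d = min \<theta> (1 - \<theta>)"
  have d: "0 < d" "d \<le> 1" "d \<le> \<theta>" "d \<le> 1 - \<theta>" using \<theta> by (auto simp: d_def)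
  have [measurable]: "(\<lambda>t. t) \<in> borel_measurable dt_over_t" "(\<lambda>t::real. ln t) \<in> borel_measurable dt_over_t"
    by (rule borel_imp_borel_measurable_dt_over_t, measurable)+
  obtain B where B: "0 < B" and bound: "\<And>g h. g \<in> borel_measurable dt_over_t \<Longrightarrow>
      (\<And>s. 0 < s \<Longrightarrow> 0 \<le> g s) \<Longrightarrow>
      (\<integral>\<^sup>+s. ennreal (g s powr q s) \<partial>dt_over_t) \<le> 1 \<Longrightarrow>
      (\<And>t. 0 < t \<Longrightarrow> 0 \<le> h t) \<Longrightarrow>
      (\<And>t. 0 < t \<Longrightarrow>
        ennreal (h t) \<le> (\<integral>\<^sup>+s. ennreal (exp (- d * \<bar>ln s - ln t\<bar>) * g s) \<partial>dt_over_t)) \<Longrightarrow>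
      (\<integral>\<^sup>+t. ennreal ((h t / B) powr q t) \<partial>dt_over_t) \<le> 1"
    using log_convolution_modular_bound[OF q d(1,2)] by blast
  show ?thesis
  proof (rule that[OF B])
    fix f u assume "u \<in> J_representations i\<^sub>0 i\<^sub>1 f"
    then have sm: "strongly_measurable dt_over_t D (inter_norm i\<^sub>0 i\<^sub>1) u"
      and int: "has_Bochner_integral_wrt dt_over_t S (sum_norm i\<^sub>0 i\<^sub>1) u f"
      by (auto simp: J_representations_def)
    have uD: "u t \<in> D" if "0 < t" for t
      using sm that by (simp add: strongly_measurable_def)
    have f: "f \<in> S" using int by (simp add: has_Bochner_integral_wrt_def)
    obtain j where [measurable]: "j \<in> borel_measurable dt_over_t"
        and j: "AE t in dt_over_t. J t (u t) = j t"
      by (rule J_representation_AE_measurable[OF sm])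
    show "K_norm i\<^sub>0 i\<^sub>1 \<theta> q f \<le> ennreal B * luxemburg_norm q (\<lambda>t. t powr - \<theta> * J t (u t))"
      unfolding K_norm_def
    proof (rule luxemburg_norm_le[OF B])
      fix l :: real
      assume l: "0 < l"
        and adm: "(\<integral>\<^sup>+t. ennreal (\<bar>t powr - \<theta> * J t (u t) / l\<bar> powr q t) \<partial>dt_over_t) \<le> 1"
      \<comment> \<open>\<open>j\<close> replaces \<open>J\<close> for measurability. The absolute
        value is taken because \<open>j\<close> is known to be nonnegative only almost
        everywhere.\<close>
      define g where "g t = \<bar>t powr - \<theta> * j t / l\<bar>" for t
      define h where "h t = t powr - \<theta> * K t f / l" for t
      have [measurable]: "g \<in> borel_measurable dt_over_t" unfolding g_def by measurable
      have "(\<integral>\<^sup>+t. ennreal ((h t / B) powr q t) \<partial>dt_over_t) \<le> 1"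
      proof (rule bound[of g])
        have "(\<integral>\<^sup>+t. ennreal (g t powr q t) \<partial>dt_over_t) =
            (\<integral>\<^sup>+t. ennreal (\<bar>t powr - \<theta> * J t (u t) / l\<bar> powr q t) \<partial>dt_over_t)"
          using j by (intro nn_integral_cong_AE) (auto simp: g_def)
        then show "(\<integral>\<^sup>+t. ennreal (g t powr q t) \<partial>dt_over_t) \<le> 1" using adm by simp
        show "0 \<le> h t" if "0 < t" for t
          using K_nonneg[of t f] f that l by (simp add: h_def)
        show "ennreal (h t) \<le> (\<integral>\<^sup>+s. ennreal (exp (- d * \<bar>ln s - ln t\<bar>) * g s) \<partial>dt_over_t)"
          if t: "0 < t" for t
        proof -
          let ?I = "\<integral>\<^sup>+s. ennreal (exp (- d * \<bar>ln s - ln t\<bar>) * g s) \<partial>dt_over_t"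
          have "ennreal (K t f) \<le> (\<integral>\<^sup>+s. ennreal (K t (u s)) \<partial>dt_over_t)"
            by (rule K_has_Bochner_integral_le[OF int t])
          also have "\<dots> \<le> (\<integral>\<^sup>+s. ennreal (l * t powr \<theta>) *
              ennreal (exp (- d * \<bar>ln s - ln t\<bar>) * g s) \<partial>dt_over_t)"
          proof (rule nn_integral_mono_AE)
            show "AE s in dt_over_t. ennreal (K t (u s)) \<le>
                ennreal (l * t powr \<theta>) * ennreal (exp (- d * \<bar>ln s - ln t\<bar>) * g s)"
              using j AE_space
            proof eventually_elim
              case (elim s)
              then have s: "0 < s" by simp
              have g: "g s = s powr - \<theta> * J s (u s) / l"
                using elim(1) J_nonneg[of s "u s"] l by (simp add: g_def)
              have "K t (u s) \<le> min 1 (t / s) * J s (u s)"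
                by (rule K_le_J[OF s t uD[OF s]])
              also have "\<dots> \<le> (t powr \<theta> * s powr - \<theta> * exp (- d * \<bar>ln s - ln t\<bar>)) * J s (u s)"
                by (intro mult_right_mono min_le_log_kernel s t d J_nonneg)
              also have "\<dots> = l * t powr \<theta> * (exp (- d * \<bar>ln s - ln t\<bar>) * g s)"
                using l by (simp add: g)
              finally show ?case
                using l J_nonneg[of s "u s"] by (simp add: ennreal_mult'[symmetric] ennreal_leI)
            qed
          qed
          also have "\<dots> = ennreal (l * t powr \<theta>) * ?I"
            by (rule nn_integral_cmult) measurable
          finally have "ennreal (t powr - \<theta> / l) * ennreal (K t f) \<le>
              ennreal (t powr - \<theta> / l) * (ennreal (l * t powr \<theta>) * ?I)"
            by (rule mult_left_mono) simp
          also have "\<dots> = (ennreal (t powr - \<theta> / l) * ennreal (l * t powr \<theta>)) * ?I"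
            by (simp only: mult.assoc)
          also have "ennreal (t powr - \<theta> / l) * ennreal (l * t powr \<theta>) = 1"
            using l t by (simp add: ennreal_mult[symmetric] powr_minus)
          finally show ?thesis
            using l K_nonneg[of t f] f t by (simp add: h_def ennreal_mult[symmetric])
        qed
      qed (auto simp: g_def)
      also have "(\<integral>\<^sup>+t. ennreal ((h t / B) powr q t) \<partial>dt_over_t) =
          (\<integral>\<^sup>+t. ennreal (\<bar>t powr - \<theta> * K t f / (B * l)\<bar> powr q t) \<partial>dt_over_t)"
        using K_nonneg f l B by (intro nn_integral_cong) (simp add: h_def abs_mult mult.commute)
      finally show "(\<integral>\<^sup>+t. ennreal (\<bar>t powr - \<theta> * K t f / (B * l)\<bar> powr q t) \<partial>dt_over_t) \<le> 1" .
    qed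
  qed
qed

end

section \<open>From the K-functional to representations\<close>

text \<open>The measure is length on the logarithmic scale; in particular every dyadic block has
  measure \<open>ln 2\<close>.\<close>

lemma emeasure_dt_over_t_atLeastLessThan:
  assumes "0 < a" "a \<le> b"
  shows "emeasure dt_over_t {a..<b} = ennreal (ln b - ln a)"
proof -
  have "emeasure dt_over_t {a..<b} = (\<integral>\<^sup>+t. indicator {a..<b} t \<partial>dt_over_t)"
  proof (rule nn_integral_indicator[symmetric])
    have "indicator {a..<b} \<in> borel_measurable dt_over_t"
      by (rule borel_imp_borel_measurable_dt_over_t) measurable
    then show "{a..<b} \<in> sets dt_over_t"
      using assms borel_measurable_indicator_iff[of "{a..<b}" dt_over_t]
      by (auto simp: Int_absorb2 subset_eq)
  qed
  also have "\<dots> = (\<integral>\<^sup>+t. ennreal (1 / t) * indicator {a..<b} t * indicator {0<..} t \<partial>lborel)"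
    by (rule nn_integral_dt_over_t) measurable
  also have "\<dots> = (\<integral>\<^sup>+t. ennreal (1 / t) * indicator {a..b} t \<partial>lborel)"
  proof (rule nn_integral_cong_AE)
    show "AE t in lborel. ennreal (1 / t) * indicator {a..<b} t * indicator {0<..} t =
        ennreal (1 / t) * indicator {a..b} t"
      using AE_lborel_singleton[of b] by eventually_elim (use assms in \<open>auto simp: indicator_def\<close>)
  qed
  also have "\<dots> = ennreal (ln b - ln a)"
  proof (rule nn_integral_has_integral_lebesgue')
    show "((\<lambda>t. 1 / t) has_integral (ln b - ln a)) {a..b}"
    proof (rule fundamental_theorem_of_calculus[OF assms(2)])
      fix t assume "t \<in> {a..b}"
      then show "(ln has_vector_derivative 1 / t) (at t within {a..b})"
        using assms by (auto intro!: has_real_derivative_iff_has_vector_derivative[THEN iffD1]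
            has_field_derivative_at_within DERIV_ln_divide)
    qed
  qed (use assms in auto)
  finally show ?thesis .
qed

context couple
begin

text \<open>\<open>K\<close> increases, so on the block from \<open>t\<close> to
  \<open>2 * t\<close> the normalised integrand has a base of at least \<open>a\<close>, built from
  the smallest weight and the smallest \<open>K\<close>. If \<open>a > 1\<close>, then
  \<open>q \<ge> 1\<close> makes its power at least \<open>a\<close> as well, and the modular bound
  limits \<open>a * ln 2\<close>.\<close>

lemma K_le_powr_if_K_norm_finite:
  assumes q: "q \<in> variable_exponents" and \<theta>: "0 < \<theta>"
    and f: "f \<in> S" and fin: "K_norm i\<^sub>0 i\<^sub>1 \<theta> q f < \<infinity>"
  obtains C where "0 < C" "\<And>t. 0 < t \<Longrightarrow> K t f \<le> C * t powr \<theta>"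
proof -
  have "{l. 0 < l \<and> (\<integral>\<^sup>+t. ennreal (\<bar>t powr - \<theta> * K t f / l\<bar> powr q t) \<partial>dt_over_t) \<le> 1} \<noteq> {}"
  proof
    assume "{l. 0 < l \<and> (\<integral>\<^sup>+t. ennreal (\<bar>t powr - \<theta> * K t f / l\<bar> powr q t) \<partial>dt_over_t) \<le> 1} = {}"
    then have "K_norm i\<^sub>0 i\<^sub>1 \<theta> q f = \<infinity>"
      unfolding K_norm_def luxemburg_norm_def by (simp only: image_empty Inf_empty infinity_ennreal_def)
    then show False using fin by simp
  qed
  then obtain l where l: "0 < l"
      and adm: "(\<integral>\<^sup>+t. ennreal (\<bar>t powr - \<theta> * K t f / l\<bar> powr q t) \<partial>dt_over_t) \<le> 1"
    by blast
  show ?thesis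
  proof (rule that[of "2 * l * 2 powr \<theta>"])
    show "0 < 2 * l * 2 powr \<theta>" using l by simp
    fix t :: real assume t: "0 < t"
    define a where "a = (2 * t) powr - \<theta> * K t f / l"
    have a0: "0 \<le> a" using K_nonneg[of t f] f t l by (simp add: a_def)
    have "a \<le> 2"
    proof (cases "a \<le> 1")
      case False
      have "ennreal a * emeasure dt_over_t {t..<2 * t} =
          (\<integral>\<^sup>+s. ennreal a * indicator {t..<2 * t} s \<partial>dt_over_t)"
      proof (rule nn_integral_cmult_indicator[symmetric])
        have "0 < emeasure dt_over_t {t..<2 * t}"
          using t by (simp add: emeasure_dt_over_t_atLeastLessThan ln_mult)
        then show "{t..<2 * t} \<in> sets dt_over_t"
          by (metis emeasure_notin_sets less_irrefl)
      qed
      also have "\<dots> \<le> (\<integral>\<^sup>+s. ennreal (\<bar>s powr - \<theta> * K s f / l\<bar> powr q s) \<partial>dt_over_t)"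
      proof (rule nn_integral_mono)
        fix s
        show "ennreal a * indicator {t..<2 * t} s \<le> ennreal (\<bar>s powr - \<theta> * K s f / l\<bar> powr q s)"
        proof (cases "s \<in> {t..<2 * t}")
          case True
          have "(2 * t) powr - \<theta> * K t f \<le> s powr - \<theta> * K s f"
            using True t \<theta> f K_mono[of t s f] K_nonneg[of t f]
            by (intro mult_mono powr_mono2') auto
          then have "a \<le> s powr - \<theta> * K s f / l"
            unfolding a_def using l by (intro divide_right_mono) auto
          from this abs_ge_self have *: "a \<le> \<bar>s powr - \<theta> * K s f / l\<bar>"
            by (rule order_trans)
          also have "\<dots> \<le> \<bar>s powr - \<theta> * K s f / l\<bar> powr q s"
            using powr_mono[of 1 "q s" "\<bar>s powr - \<theta> * K s f / l\<bar>"] * False q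
            by (simp add: variable_exponents_def)
          finally show ?thesis using True by (simp add: ennreal_leI)
        qed simp
      qed
      also have "\<dots> \<le> 1" by (rule adm)
      finally have "ennreal (a * ln 2) \<le> ennreal 1"
        using t a0 by (simp add: emeasure_dt_over_t_atLeastLessThan ln_mult ennreal_mult)
      then have "a * ln 2 \<le> 1" by (subst (asm) ennreal_le_iff) auto
      moreover have "a * (2 / 3) \<le> a * ln 2"
        using a0 ln2_ge_two_thirds by (intro mult_left_mono) auto
      ultimately show ?thesis by simp
    qed simp
    then show "K t f \<le> 2 * l * 2 powr \<theta> * t powr \<theta>"
      using l t by (simp add: a_def powr_mult powr_minus field_simps)
  qed
qed

text \<open>
  The fundamental lemma of interpolation theory: telescoping near-optimal decompositions
  \<open>f = i\<^sub>0 (a j) + i\<^sub>1 (b j)\<close> at \<open>t = 2 ^ j\<close>.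
\<close>

lemma exists_J_representation:
  assumes \<theta>: "0 < \<theta>" "\<theta> < 1" and f: "f \<in> S" and C: "0 < C"
    and growth: "\<And>t. 0 < t \<Longrightarrow> K t f \<le> C * t powr \<theta>"
  obtains u where "u \<in> J_representations i\<^sub>0 i\<^sub>1 f" "\<And>t. 0 < t \<Longrightarrow> J t (u t) \<le> 8 / ln 2 * K t f"
proof -
  have pos: "(0::real) < 2 powi j" for j :: int by simp
  \<comment> \<open>The factor \<open>2\<close> leaves room above the infimum only if
    \<open>K\<close> is positive, which is the reason for \<open>K_eq_0_imp\<close>;
    \<open>f = 0\<close> is decomposed trivially.\<close>
  have "\<exists>a b. f = i\<^sub>0 a + i\<^sub>1 b \<and> norm a + 2 powi j * norm b \<le> 2 * K (2 powi j) f" for j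
  proof (cases "f = 0")
    case True
    then show ?thesis
      using linear_0[OF linear0] linear_0[OF linear1] K_zero[OF less_imp_le[OF pos]]
      by (intro exI[of _ 0]) simp
  next
    case False
    then have "K (2 powi j) f \<noteq> 0" using K_eq_0_imp[OF pos f] by blast
    then have "K (2 powi j) f < 2 * K (2 powi j) f"
      using K_nonneg[OF less_imp_le[OF pos] f, of j] by linarith
    with f obtain a b where "f = i\<^sub>0 a + i\<^sub>1 b" "norm a + 2 powi j * norm b < 2 * K (2 powi j) f"
      by (rule K_decomposition)
    then show ?thesis by (intro exI[of _ a] exI[of _ b] conjI less_imp_le)
  qed
  then obtain a b where ab: "\<And>j. f = i\<^sub>0 (a j) + i\<^sub>1 (b j)"
      and le: "\<And>j. norm (a j) + 2 powi j * norm (b j) \<le> 2 * K (2 powi j) f"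
    by metis
  have a_le: "norm (a j) \<le> 2 * K (2 powi j) f" and b_le: "2 powi j * norm (b j) \<le> 2 * K (2 powi j) f" for j
    using le[of j] mult_nonneg_nonneg[OF less_imp_le[OF pos[of j]] norm_ge_zero[of "b j"]]
      norm_ge_zero[of "a j"] by linarith+
  \<comment> \<open>Two decompositions of the same \<open>f\<close> differ by an element of both
    ranges, so each increment lies in the intersection.\<close>
  define U where "U j = i\<^sub>0 (a (j + 1) - a j)" for j
  have U1: "U j = i\<^sub>1 (b j - b (j + 1))" for j
    using trans[OF ab[of j, symmetric] ab[of "j + 1"]] unfolding U_def
    by (simp add: linear_diff[OF linear0] linear_diff[OF linear1] algebra_simps)
  have UD: "U j \<in> D" for j
    unfolding inter_space_def
  proof
    show "U j \<in> range i\<^sub>0" unfolding U_def by (rule rangeI)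
    show "U j \<in> range i\<^sub>1" unfolding U1 by (rule rangeI)
  qed
  define E where "E t = \<lfloor>log 2 t\<rfloor>" for t :: real
  have E: "E t = j \<longleftrightarrow> 2 powi j \<le> t \<and> t < 2 powi (j + 1)" if "0 < t" for t j
  proof -
    have "E t = j \<longleftrightarrow> 2 powr real_of_int j \<le> t \<and> t < 2 powr (real_of_int (j + 1))"
      using that unfolding E_def floor_eq_iff by (simp add: le_log_iff log_less_iff)
    then show ?thesis by (simp add: powr_real_of_int' del: of_int_add)
  qed
  \<comment> \<open>\<open>E t\<close> is the index of the dyadic block of \<open>t\<close>. Blocks
    have measure \<open>ln 2\<close>, so with this factor block \<open>j\<close> contributes exactly
    \<open>U j\<close> to the integral.\<close>
  define u where "u t = (1 / ln 2) *\<^sub>R U (E t)" for t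
  have uD: "u t \<in> D" for t
    unfolding u_def by (intro subspace_scale[OF subspace_inter_space] UD)
  have K0: "0 \<le> K t f" if "0 < t" for t using K_nonneg[of t f] f that by simp
  have Ju: "J t (u t) \<le> 8 / ln 2 * K t f" if t: "0 < t" for t
  proof -
    define j where "j = E t"
    have j: "2 powi j \<le> t" "t < 2 powi (j + 1)" using E[OF t, of j] by (auto simp: j_def)
    have j2: "(2::real) powi (j + 1) = 2 * 2 powi j" for j :: int
      by (simp add: power_int_add)
    have K1: "K (2 powi j) f \<le> K t f" using K_mono[of "2 powi j" t f] j f pos[of j] by simp
    have K2: "K (2 powi (j + 1)) f \<le> 2 * K (2 powi j) f"
      using K_quotient_antimono[of "2 powi j" "2 powi (j + 1)" f] f pos[of j] by (simp add: j2)
    have "norm (a (j + 1) - a j) \<le> norm (a (j + 1)) + norm (a j)" by (rule norm_triangle_ineq4)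
    also have "\<dots> \<le> 8 * K t f"
      using a_le[of j] a_le[of "j + 1"] K1 K2 K0[OF t] by linarith
    finally have A: "norm (a (j + 1) - a j) \<le> 8 * K t f" .
    have "t * norm (b j - b (j + 1)) \<le> 2 powi (j + 1) * (norm (b j) + norm (b (j + 1)))"
      using j pos[of "j + 1"] by (intro mult_mono norm_triangle_ineq4) auto
    also have "\<dots> = 2 * (2 powi j * norm (b j)) + 2 powi (j + 1) * norm (b (j + 1))"
      by (simp add: j2 distrib_left)
    \<comment> \<open>This component fixes the constant: each of the two summands is at most
      \<open>4 * K (2 powi j) f\<close>, because \<open>t\<close> may come close to
      \<open>2 powi (j + 1)\<close>.\<close>
    also have "\<dots> \<le> 8 * K t f"
      using b_le[of j] b_le[of "j + 1"] K1 K2 by linarith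
    finally have B: "t * norm (b j - b (j + 1)) \<le> 8 * K t f" .
    have "u t = i\<^sub>0 ((1 / ln 2) *\<^sub>R (a (j + 1) - a j))"
      unfolding u_def j_def[symmetric] U_def by (rule linear_scale[OF linear0, symmetric])
    then have "inv i\<^sub>0 (u t) = (1 / ln 2) *\<^sub>R (a (j + 1) - a j)" by (simp only: inv0)
    then have inv_a: "norm (inv i\<^sub>0 (u t)) = norm (a (j + 1) - a j) / ln 2"
      by (simp only: norm_scaleR) simp
    have "u t = i\<^sub>1 ((1 / ln 2) *\<^sub>R (b j - b (j + 1)))"
      unfolding u_def j_def[symmetric] U1 by (rule linear_scale[OF linear1, symmetric])
    then have "inv i\<^sub>1 (u t) = (1 / ln 2) *\<^sub>R (b j - b (j + 1))" by (simp only: inv1)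
    then have inv_b: "norm (inv i\<^sub>1 (u t)) = norm (b j - b (j + 1)) / ln 2"
      by (simp only: norm_scaleR) simp
    show ?thesis
      using divide_right_mono[OF A, of "ln 2"] divide_right_mono[OF B, of "ln 2"]
      unfolding J_functional_def inv_a inv_b by simp
  qed
  define d where "d = min \<theta> (1 - \<theta>)"
  have d: "0 < d" "d \<le> \<theta>" "d \<le> 1 - \<theta>" using \<theta> by (auto simp: d_def)
  define N where "N = sum_norm i\<^sub>0 i\<^sub>1"
  have N0: "N 0 = 0" by (simp add: N_def sum_norm_eq_K K_zero)
  \<comment> \<open>\<open>N\<close> is \<open>K\<close> at the point \<open>1\<close>; the growth
    condition then gives exponential decay in \<open>\<bar>ln t\<bar>\<close> at both ends, hence
    convergence in the sum.\<close>
  have Nu: "N (u t) \<le> 8 / ln 2 * C * exp (- d * \<bar>ln t\<bar>)" if t: "0 < t" for t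
  proof -
    have "N (u t) \<le> min 1 (1 / t) * J t (u t)"
      unfolding N_def sum_norm_eq_K by (rule K_le_J[OF t _ uD]) simp
    also have "\<dots> \<le> (t powr - \<theta> * exp (- d * \<bar>ln t\<bar>)) * (8 / ln 2 * (C * t powr \<theta>))"
    proof (rule mult_mono)
      show "min 1 (1 / t) \<le> t powr - \<theta> * exp (- d * \<bar>ln t\<bar>)"
        using min_le_log_kernel[of t 1 d \<theta>] t d by simp
      have "J t (u t) \<le> 8 / ln 2 * K t f" by (rule Ju[OF t])
      also have "\<dots> \<le> 8 / ln 2 * (C * t powr \<theta>)"
        by (intro mult_left_mono growth t) simp
      finally show "J t (u t) \<le> 8 / ln 2 * (C * t powr \<theta>)" .
    qed (simp_all add: J_nonneg)
    also have "\<dots> = 8 / ln 2 * C * exp (- d * \<bar>ln t\<bar>)"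
      using t by (simp add: powr_minus field_simps)
    finally show ?thesis .
  qed
  define I where "I n = {- int n..<int n}" for n
  define F where "F n j = (if j \<in> I n then (1 / ln 2) *\<^sub>R U j else 0)" for n j
  define s where "s n t = F n (E t)" for n t
  \<comment> \<open>Values of \<open>U\<close> may coincide or vanish, so the level sets of
    \<open>s n\<close> are inconvenient; those of \<open>H n\<close> for indices in
    \<open>I n\<close> are dyadic blocks. All other \<open>t\<close> receive the default
    \<open>int n\<close>, which lies just outside \<open>I n\<close>, so that \<open>F n\<close> is
    \<open>0\<close> there.\<close>
  define H where "H n t = (if E t \<in> I n then E t else int n)" for n t
  have FD: "F n j \<in> D" for n j
    unfolding F_def using subspace_0[OF subspace_inter_space]
    by (auto intro: subspace_scale[OF subspace_inter_space] UD)
  have sH: "s n t = F n (H n t)" for n t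
    by (simp add: s_def H_def F_def I_def)
  have E_vimage: "E -` {j} \<inter> {0<..} = {2 powi j..<2 powi (j + 1)}" for j
  proof (rule set_eqI)
    fix t :: real
    show "t \<in> E -` {j} \<inter> {0<..} \<longleftrightarrow> t \<in> {2 powi j..<2 powi (j + 1)}"
      using E[of t j] less_le_trans[OF pos[of j], of t] by auto
  qed
  have E_measure: "emeasure dt_over_t {2 powi j..<2 powi (j + 1)} = ennreal (ln 2)" for j :: int
  proof -
    have "ln (2 powi j) = real_of_int j * ln (2::real)" for j
      using ln_powr[of 2 "real_of_int j"] by (simp add: powr_real_of_int')
    from this[of "j + 1"] this[of j] have "ln (2 powi (j + 1)) - ln (2 powi j) = ln (2::real)"
      by (simp add: algebra_simps)
    moreover have "2 powi j \<le> (2 powi (j + 1) :: real)"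
      by (simp add: power_int_increasing)
    ultimately show ?thesis
      using emeasure_dt_over_t_atLeastLessThan[of "2 powi j" "2 powi (j + 1)"] by simp
  qed
  have E_sets: "{2 powi j..<2 powi (j + 1)} \<in> sets dt_over_t" for j :: int
    using E_measure[of j] emeasure_notin_sets[of "{2 powi j..<2 powi (j + 1)}" dt_over_t] by force
  have H_simple: "simple_function dt_over_t (H n)" for n
    unfolding simple_function_def
  proof
    have range: "H n ` space dt_over_t \<subseteq> insert (int n) (I n)" by (auto simp: H_def)
    then show "finite (H n ` space dt_over_t)"
      by (rule finite_subset) (simp add: I_def)
    have inside: "H n -` {j} \<inter> space dt_over_t = {2 powi j..<2 powi (j + 1)}" if "j \<in> I n" for j
      using that E_vimage[of j] by (auto simp: H_def I_def split: if_splits)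
    have outside: "H n -` {int n} \<inter> space dt_over_t =
        space dt_over_t - (\<Union>j\<in>I n. {2 powi j..<2 powi (j + 1)})"
      unfolding E_vimage[symmetric] by (auto simp: H_def I_def split: if_splits)
    show "\<forall>j\<in>H n ` space dt_over_t. H n -` {j} \<inter> space dt_over_t \<in> sets dt_over_t"
    proof
      fix j assume "j \<in> H n ` space dt_over_t"
      then consider "j \<in> I n" | "j = int n" using range by blast
      then show "H n -` {j} \<inter> space dt_over_t \<in> sets dt_over_t"
      proof cases
        case 1
        show ?thesis unfolding inside[OF 1] by (rule E_sets)
      next
        case 2
        show ?thesis unfolding 2 outside
          by (intro sets.Diff sets.top sets.finite_UN E_sets) (simp add: I_def)
      qed
    qed
  qed
  have s_simple: "simple_function dt_over_t (s n)" for n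
  proof -
    have "s n = (\<lambda>t. F n (H n t))" by (rule ext) (rule sH)
    then show ?thesis using simple_function_compose1[OF H_simple, of "F n"] by simp
  qed
  have support: "{t \<in> space dt_over_t. s n t \<noteq> 0} \<subseteq> (\<Union>j\<in>I n. {2 powi j..<2 powi (j + 1)})" for n
    unfolding E_vimage[symmetric] by (auto simp: s_def F_def split: if_splits)
  have s_integrable: "Bochner_Integration.simple_bochner_integrable dt_over_t (s n)" for n
  proof (rule Bochner_Integration.simple_bochner_integrable.intros[OF s_simple])
    have "emeasure dt_over_t {t \<in> space dt_over_t. s n t \<noteq> 0} \<le>
        emeasure dt_over_t (\<Union>j\<in>I n. {2 powi j..<2 powi (j + 1)})"
      by (intro emeasure_mono support sets.finite_UN E_sets) (simp add: I_def)
    also have "\<dots> \<le> (\<Sum>j\<in>I n. emeasure dt_over_t {2 powi j..<2 powi (j + 1)})"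
      by (intro emeasure_subadditive_finite) (auto simp: I_def E_sets)
    also have "\<dots> < \<infinity>"
      unfolding E_measure by (simp add: I_def ennreal_mult_less_top of_nat_less_top)
    finally show "emeasure dt_over_t {t \<in> space dt_over_t. s n t \<noteq> 0} \<noteq> \<infinity>" by simp
  qed
  have s_integral: "Bochner_Integration.simple_bochner_integral dt_over_t (s n) = i\<^sub>0 (a (int n) - a (- int n))" for n
  proof -
    have "Bochner_Integration.simple_bochner_integral dt_over_t (s n) =
        (\<Sum>j\<in>H n ` space dt_over_t. measure dt_over_t {t \<in> space dt_over_t. H n t = j} *\<^sub>R F n j)"
      by (rule simple_bochner_integral_partition[OF s_integrable H_simple]) (auto simp: sH)
    also have "\<dots> = (\<Sum>j\<in>I n. measure dt_over_t {t \<in> space dt_over_t. H n t = j} *\<^sub>R F n j)"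
    proof (rule sum.mono_neutral_right)
      show "finite (H n ` space dt_over_t)" using H_simple by (rule simple_functionD)
      show "I n \<subseteq> H n ` space dt_over_t"
      proof
        fix j assume "j \<in> I n"
        then have "H n (2 powi j) = j"
          using E[OF pos[of j], of j] by (simp add: H_def power_int_strict_increasing)
        then show "j \<in> H n ` space dt_over_t" using pos[of j]
          by (metis greaterThan_iff image_eqI space_dt_over_t)
      qed
    qed (auto simp: F_def)
    also have "\<dots> = (\<Sum>j\<in>I n. U j)"
    proof (rule sum.cong[OF refl])
      fix j assume j: "j \<in> I n"
      have "{t \<in> space dt_over_t. H n t = j} = E -` {j} \<inter> {0<..}"
        using j by (auto simp: H_def I_def split: if_splits)
      then have "measure dt_over_t {t \<in> space dt_over_t. H n t = j} = ln 2"
        unfolding E_vimage by (simp add: measure_def E_measure)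
      then show "measure dt_over_t {t \<in> space dt_over_t. H n t = j} *\<^sub>R F n j = U j"
        using j by (simp add: F_def)
    qed
    also have "\<dots> = i\<^sub>0 (a (int n) - a (- int n))"
    proof (induction n)
      case 0
      then show ?case by (simp add: I_def linear_0[OF linear0])
    next
      case (Suc n)
      \<comment> \<open>The interval grows by one index at each end, and the new increments cancel
        the old boundary terms.\<close>
      have "I (Suc n) = insert (- int (Suc n)) (insert (int n) (I n))"
        by (auto simp: I_def)
      then have "sum U (I (Suc n)) = U (- int (Suc n)) + (U (int n) + sum U (I n))"
        by (simp add: I_def)
      also have "\<dots> = i\<^sub>0 (a (int (Suc n)) - a (- int (Suc n)))"
        unfolding Suc.IH U_def
        by (simp add: linear_add[OF linear0, symmetric] add.commute[of 1])
      finally show ?case .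
    qed
    finally show ?thesis .
  qed
  \<comment> \<open>At each \<open>t > 0\<close> the truncations equal \<open>u t\<close> from some
    \<open>n\<close> on, so only \<open>P 0 = 0\<close> matters. One statement thus serves both the
    intersection and the sum with their different norms.\<close>
  have u_strongly: "strongly_measurable dt_over_t A P u"
    if "\<And>x. x \<in> D \<Longrightarrow> x \<in> A" "P 0 = 0" for A and P :: "'v \<Rightarrow> real"
    unfolding strongly_measurable_def
  proof (intro conjI exI[of _ s] allI ballI s_simple)
    show "u t \<in> A" for t by (intro that uD)
    show "s n t \<in> A" for n t unfolding s_def by (intro that FD)
    show "AE t in dt_over_t. (\<lambda>n. P (u t - s n t)) \<longlonglongrightarrow> 0"
    proof (intro always_eventually allI)
      fix t
      have "P (u t - s n t) = 0" if "nat \<bar>E t\<bar> + 1 \<le> n" for n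
      proof -
        have "E t \<in> I n" using that by (auto simp: I_def)
        then show ?thesis using \<open>P 0 = 0\<close> by (simp add: u_def s_def F_def)
      qed
      then show "(\<lambda>n. P (u t - s n t)) \<longlonglongrightarrow> 0"
        by (intro tendsto_eventually eventually_sequentiallyI)
    qed
  qed
  have L1: "(\<lambda>n. \<integral>\<^sup>+t. ennreal (N (u t - s n t)) \<partial>dt_over_t) \<longlonglongrightarrow> 0"
  proof -
    \<comment> \<open>The error lives where \<open>\<bar>ln t\<bar> \<ge> n * ln 2\<close>. Half of
      the decay there yields the small factor \<open>c n\<close>, the other half keeps the integral
      finite.\<close>
    define c where "c n = 8 / ln 2 * C * exp (- (d / 2) * (real n * ln 2))" for n
    have c0: "0 \<le> c n" for n using C by (simp add: c_def)
    have le: "(\<integral>\<^sup>+t. ennreal (N (u t - s n t)) \<partial>dt_over_t) \<le> ennreal (c n) * ennreal (2 / (d / 2))" for n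
    proof -
      have "(\<integral>\<^sup>+t. ennreal (N (u t - s n t)) \<partial>dt_over_t) \<le>
          (\<integral>\<^sup>+t. ennreal (c n) * ennreal (exp (- (d / 2) * \<bar>ln 1 - ln t\<bar>)) \<partial>dt_over_t)"
      proof (rule nn_integral_mono)
        fix t assume "t \<in> space dt_over_t"
        then have t: "0 < t" by simp
        have "N (u t - s n t) \<le> c n * exp (- (d / 2) * \<bar>ln 1 - ln t\<bar>)"
        proof (cases "E t \<in> I n")
          case True
          then show ?thesis using c0 N0 by (simp add: u_def s_def F_def)
        next
          case False
          then have "real n * ln 2 \<le> \<bar>ln t\<bar>"
          proof -
            have "real n \<le> \<bar>log 2 t\<bar>"
              using False unfolding I_def E_def by (auto simp: le_floor_iff floor_less_iff not_less)
            then have "real n * ln 2 \<le> \<bar>log 2 t\<bar> * ln 2" by (rule mult_right_mono) simp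
            then show ?thesis by (simp add: log_def)
          qed
          then have "(d / 2) * (real n * ln 2) \<le> (d / 2) * \<bar>ln t\<bar>"
            using d by (intro mult_left_mono) auto
          then have *: "exp (- d * \<bar>ln t\<bar>) \<le> exp (- (d / 2) * (real n * ln 2)) * exp (- (d / 2) * \<bar>ln t\<bar>)"
            by (simp add: exp_add[symmetric])
          have "N (u t - s n t) = N (u t)" using False by (simp add: s_def F_def)
          also have "\<dots> \<le> 8 / ln 2 * C * exp (- d * \<bar>ln t\<bar>)" by (rule Nu[OF t])
          also have "\<dots> \<le> 8 / ln 2 * C * (exp (- (d / 2) * (real n * ln 2)) * exp (- (d / 2) * \<bar>ln t\<bar>))"
            using * C by (intro mult_left_mono) auto
          finally show ?thesis by (simp add: c_def mult_ac)
        qed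
        then show "ennreal (N (u t - s n t)) \<le> ennreal (c n) * ennreal (exp (- (d / 2) * \<bar>ln 1 - ln t\<bar>))"
          using c0 by (simp add: ennreal_mult[symmetric] ennreal_leI)
      qed
      also have "\<dots> = ennreal (c n) * (\<integral>\<^sup>+t. ennreal (exp (- (d / 2) * \<bar>ln 1 - ln t\<bar>)) \<partial>dt_over_t)"
        by (rule nn_integral_cmult, rule borel_imp_borel_measurable_dt_over_t) measurable
      also have "\<dots> \<le> ennreal (c n) * ennreal (2 / (d / 2))"
        using d by (intro mult_left_mono nn_integral_log_kernel_le) auto
      finally show ?thesis .
    qed
    have lim: "(\<lambda>n. ennreal (c n) * ennreal (2 / (d / 2))) \<longlonglongrightarrow> 0"
    proof -
      have "(\<lambda>n. exp (- (d / 2) * ln 2) ^ n) \<longlonglongrightarrow> 0"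
        using d by (intro LIMSEQ_power_zero) simp
      then have "(\<lambda>n. 8 / ln 2 * C * exp (- (d / 2) * ln 2) ^ n * (2 / (d / 2))) \<longlonglongrightarrow>
          8 / ln 2 * C * 0 * (2 / (d / 2))"
        by (intro tendsto_mult_left tendsto_mult_right)
      then have "(\<lambda>n. c n * (2 / (d / 2))) \<longlonglongrightarrow> 0"
        by (simp add: c_def exp_of_nat_mult[symmetric] mult_ac)
      then have "(\<lambda>n. ennreal (c n * (2 / (d / 2)))) \<longlonglongrightarrow> ennreal 0"
        by (rule tendsto_ennrealI)
      moreover have "ennreal (c n * (2 / (d / 2))) = ennreal (c n) * ennreal (2 / (d / 2))" for n
        using d c0 by (intro ennreal_mult) auto
      ultimately show ?thesis by simp
    qed
    show ?thesis
      by (rule tendsto_sandwich[OF _ _ tendsto_const lim]) (simp, intro always_eventually allI le)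
  qed
  have L2: "(\<lambda>n. N (Bochner_Integration.simple_bochner_integral dt_over_t (s n) - f)) \<longlonglongrightarrow> 0"
  proof (rule tendsto_sandwich[OF _ _ tendsto_const])
    have le: "N (Bochner_Integration.simple_bochner_integral dt_over_t (s n) - f) \<le>
        2 * C * (2 powr - \<theta>) ^ n + 2 * C * (2 powr (\<theta> - 1)) ^ n" for n
    proof -
      \<comment> \<open>Writing \<open>f\<close> with its decomposition at index \<open>n\<close>
        cancels \<open>a (int n)\<close>. Of the two remainders, \<open>a (- int n)\<close> decays
        because \<open>\<theta> > 0\<close> and \<open>b (int n)\<close> because
        \<open>\<theta> < 1\<close>.\<close>
      have "Bochner_Integration.simple_bochner_integral dt_over_t (s n) - f =
          i\<^sub>0 (- a (- int n)) + i\<^sub>1 (- b (int n))"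
        unfolding s_integral using ab[of "int n"]
        by (simp add: linear_diff[OF linear0] linear_neg[OF linear0] linear_neg[OF linear1])
      then have "N (Bochner_Integration.simple_bochner_integral dt_over_t (s n) - f) \<le>
          norm (a (- int n)) + norm (b (int n))"
        unfolding N_def sum_norm_eq_K using K_le[of 1 _ "- a (- int n)" "- b (int n)"] by simp
      also have "norm (a (- int n)) \<le> 2 * C * (2 powr - \<theta>) ^ n"
      proof -
        have "norm (a (- int n)) \<le> 2 * (C * (2 powi (- int n)) powr \<theta>)"
          using a_le[of "- int n"] growth[OF pos[of "- int n"]] by linarith
        also have "2 powi (- int n) = (2 powr - real n :: real)"
          using powr_real_of_int'[of 2 "- int n"] by simp
        also have "(2 powr - real n) powr \<theta> = (2 powr - \<theta> :: real) ^ n"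
          by (simp add: powr_powr powr_power)
        finally show ?thesis by (simp add: mult_ac)
      qed
      also have "norm (b (int n)) \<le> 2 * C * (2 powr (\<theta> - 1)) ^ n"
      proof -
        have "2 ^ n * norm (b (int n)) \<le> 2 * (C * (2 ^ n) powr \<theta>)"
          using b_le[of "int n"] growth[OF pos[of "int n"]] by simp
        then have "norm (b (int n)) \<le> 2 * C * ((2 ^ n) powr \<theta> / 2 ^ n)"
          by (simp add: field_simps)
        also have "(2 ^ n) powr \<theta> / 2 ^ n = (2 powr (\<theta> - 1) :: real) ^ n"
          by (simp add: powr_realpow[symmetric] powr_powr powr_diff[symmetric] algebra_simps)
        finally show ?thesis .
      qed
      finally show ?thesis by simp
    qed
    show "\<forall>\<^sub>F n in sequentially. N (Bochner_Integration.simple_bochner_integral dt_over_t (s n) - f) \<le>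
        2 * C * (2 powr - \<theta>) ^ n + 2 * C * (2 powr (\<theta> - 1)) ^ n"
      using le by (intro always_eventually allI)
    show "\<forall>\<^sub>F n in sequentially. 0 \<le> N (Bochner_Integration.simple_bochner_integral dt_over_t (s n) - f)"
    proof (intro always_eventually allI)
      fix n
      have "s n t \<in> S" for t unfolding s_def by (intro inter_subset_sum FD)
      then have "Bochner_Integration.simple_bochner_integral dt_over_t (s n) - f \<in> S"
        by (intro subspace_diff[OF subspace_sum_space] simple_bochner_integral_in_sum_space f)
      then show "0 \<le> N (Bochner_Integration.simple_bochner_integral dt_over_t (s n) - f)"
        unfolding N_def sum_norm_eq_K by (intro K_nonneg) auto
    qed
    have "(\<lambda>n. 2 * C * (2 powr - \<theta>) ^ n + 2 * C * (2 powr (\<theta> - 1)) ^ n) \<longlonglongrightarrow> 2 * C * 0 + 2 * C * 0"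
    proof (intro tendsto_add tendsto_mult_left LIMSEQ_power_zero)
      show "norm (2 powr - \<theta> :: real) < 1" "norm (2 powr (\<theta> - 1) :: real) < 1"
        using \<theta> by (simp_all add: powr_less_one)
    qed
    then show "(\<lambda>n. 2 * C * (2 powr - \<theta>) ^ n + 2 * C * (2 powr (\<theta> - 1)) ^ n) \<longlonglongrightarrow> 0" by simp
  qed
  have "inter_norm i\<^sub>0 i\<^sub>1 0 = 0"
    using inv0[of 0] inv1[of 0] by (simp add: inter_norm_def linear_0[OF linear0] linear_0[OF linear1])
  then have "strongly_measurable dt_over_t D (inter_norm i\<^sub>0 i\<^sub>1) u"
    by (intro u_strongly)
  moreover have "has_Bochner_integral_wrt dt_over_t S N u f"
    unfolding has_Bochner_integral_wrt_def
  proof (intro conjI exI[of _ s] allI ballI)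
    show "strongly_measurable dt_over_t S N u" using N0 by (intro u_strongly inter_subset_sum)
    show "s n t \<in> S" for n t unfolding s_def by (intro inter_subset_sum FD)
  qed (use f s_integrable L1 L2 in auto)
  ultimately have "u \<in> J_representations i\<^sub>0 i\<^sub>1 f"
    by (simp add: J_representations_def N_def)
  then show ?thesis using Ju that by blast
qed

end

section \<open>Equality of the two spaces and equivalence of their norms\<close>

theorem theorem3:
  fixes i\<^sub>0 :: "'a::banach \<Rightarrow> 'v::{real_vector, topological_ab_group_add, t2_space}"
    and i\<^sub>1 :: "'b::banach \<Rightarrow> 'v"
    and \<theta> :: real and q :: "real \<Rightarrow> real"
  assumes "compatible_couple i\<^sub>0 i\<^sub>1"
    and "0 < \<theta>" and "\<theta> < 1"
    and "q \<in> variable_exponents"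
    and "log_Hoelder_at_origin q"
    and "log_Hoelder_at_infinity q"
  shows "J_space i\<^sub>0 i\<^sub>1 \<theta> q = K_space i\<^sub>0 i\<^sub>1 \<theta> q \<and>
    (\<exists>c C. 0 < c \<and> 0 < C \<and>
      (\<forall>f \<in> K_space i\<^sub>0 i\<^sub>1 \<theta> q.
         ennreal c * K_norm i\<^sub>0 i\<^sub>1 \<theta> q f \<le> J_norm i\<^sub>0 i\<^sub>1 \<theta> q f \<and>
         J_norm i\<^sub>0 i\<^sub>1 \<theta> q f \<le> ennreal C * K_norm i\<^sub>0 i\<^sub>1 \<theta> q f))"
proof -
  interpret couple i\<^sub>0 i\<^sub>1 by standard fact
  obtain B where B: "0 < B" and upper: "\<And>f u. u \<in> J_representations i\<^sub>0 i\<^sub>1 f \<Longrightarrow>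
      K_norm i\<^sub>0 i\<^sub>1 \<theta> q f \<le> ennreal B * luxemburg_norm q (\<lambda>t. t powr - \<theta> * J_functional i\<^sub>0 i\<^sub>1 t (u t))"
    using K_norm_le_J_representation[OF assms(2-6)] by blast
  have cancel: "ennreal (1 / B) * (ennreal B * x) = x" for x
  proof -
    have "ennreal (1 / B) * ennreal B = 1" using B by (simp add: ennreal_mult[symmetric])
    then show ?thesis by (simp add: mult.assoc[symmetric])
  qed
  \<comment> \<open>This holds for every \<open>f\<close>: without representations the infimum on
    the right is infinite.\<close>
  have K_le_J: "ennreal (1 / B) * K_norm i\<^sub>0 i\<^sub>1 \<theta> q f \<le> J_norm i\<^sub>0 i\<^sub>1 \<theta> q f" for f
    unfolding J_norm_def
  proof (rule INF_greatest)
    fix u assume "u \<in> J_representations i\<^sub>0 i\<^sub>1 f"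
    from mult_left_mono[OF upper[OF this], of "ennreal (1 / B)"]
    show "ennreal (1 / B) * K_norm i\<^sub>0 i\<^sub>1 \<theta> q f \<le>
        luxemburg_norm q (\<lambda>t. t powr - \<theta> * J_functional i\<^sub>0 i\<^sub>1 t (u t))"
      by (simp add: cancel)
  qed
  have J_le_K: "J_representations i\<^sub>0 i\<^sub>1 f \<noteq> {} \<and>
      J_norm i\<^sub>0 i\<^sub>1 \<theta> q f \<le> ennreal (8 / ln 2) * K_norm i\<^sub>0 i\<^sub>1 \<theta> q f"
    if "f \<in> K_space i\<^sub>0 i\<^sub>1 \<theta> q" for f
  proof -
    from that have f: "f \<in> sum_space i\<^sub>0 i\<^sub>1" "K_norm i\<^sub>0 i\<^sub>1 \<theta> q f < \<infinity>"
      by (auto simp: K_space_def)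
    \<comment> \<open>This \<open>C\<close> depends on \<open>f\<close>, but it enters only the
      convergence of the representation. The norm estimate uses the pointwise bound with the
      universal constant \<open>8 / ln 2\<close>.\<close>
    obtain C where "0 < C" "\<And>t. 0 < t \<Longrightarrow> K_functional i\<^sub>0 i\<^sub>1 t f \<le> C * t powr \<theta>"
      using K_le_powr_if_K_norm_finite[OF assms(4,2) f] by blast
    then obtain u where u: "u \<in> J_representations i\<^sub>0 i\<^sub>1 f"
        and Ju: "\<And>t. 0 < t \<Longrightarrow> J_functional i\<^sub>0 i\<^sub>1 t (u t) \<le> 8 / ln 2 * K_functional i\<^sub>0 i\<^sub>1 t f"
      using exists_J_representation[OF assms(2,3) f(1)] by blast
    have "J_norm i\<^sub>0 i\<^sub>1 \<theta> q f \<le> luxemburg_norm q (\<lambda>t. t powr - \<theta> * J_functional i\<^sub>0 i\<^sub>1 t (u t))"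
      unfolding J_norm_def by (rule INF_lower[OF u])
    also have "\<dots> \<le> ennreal (8 / ln 2) * K_norm i\<^sub>0 i\<^sub>1 \<theta> q f"
      unfolding K_norm_def
    proof (rule luxemburg_norm_mono)
      fix t :: real assume t: "0 < t"
      show "0 \<le> q t" using assms(4) order_trans[OF zero_le_one] by (auto simp: variable_exponents_def)
      have "t powr - \<theta> * J_functional i\<^sub>0 i\<^sub>1 t (u t) \<le> t powr - \<theta> * (8 / ln 2 * K_functional i\<^sub>0 i\<^sub>1 t f)"
        by (intro mult_left_mono Ju t) simp
      then show "\<bar>t powr - \<theta> * J_functional i\<^sub>0 i\<^sub>1 t (u t)\<bar> \<le> 8 / ln 2 * \<bar>t powr - \<theta> * K_functional i\<^sub>0 i\<^sub>1 t f\<bar>"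
        using J_nonneg[of t "u t"] K_nonneg[OF less_imp_le[OF t] f(1)]
        by (simp add: abs_mult mult_ac)
    qed simp
    finally show ?thesis using u by blast
  qed
  have "J_space i\<^sub>0 i\<^sub>1 \<theta> q = K_space i\<^sub>0 i\<^sub>1 \<theta> q"
  proof (intro subset_antisym subsetI)
    fix f assume "f \<in> J_space i\<^sub>0 i\<^sub>1 \<theta> q"
    then have f: "f \<in> sum_space i\<^sub>0 i\<^sub>1" "J_norm i\<^sub>0 i\<^sub>1 \<theta> q f < \<infinity>" by (auto simp: J_space_def)
    have "K_norm i\<^sub>0 i\<^sub>1 \<theta> q f \<noteq> \<infinity>"
    proof
      assume "K_norm i\<^sub>0 i\<^sub>1 \<theta> q f = \<infinity>"
      then show False using K_le_J[of f] f(2) B by (simp add: ennreal_mult_top top_unique)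
    qed
    then show "f \<in> K_space i\<^sub>0 i\<^sub>1 \<theta> q" using f(1) by (simp add: K_space_def less_top)
  next
    fix f assume f: "f \<in> K_space i\<^sub>0 i\<^sub>1 \<theta> q"
    then have "ennreal (8 / ln 2) * K_norm i\<^sub>0 i\<^sub>1 \<theta> q f < \<infinity>"
      by (simp add: K_space_def ennreal_mult_less_top)
    then have "J_norm i\<^sub>0 i\<^sub>1 \<theta> q f < \<infinity>" using J_le_K[OF f] by (meson le_less_trans)
    then show "f \<in> J_space i\<^sub>0 i\<^sub>1 \<theta> q"
      using J_le_K[OF f] f by (simp add: J_space_def K_space_def)
  qed
  moreover have "\<exists>c C. 0 < c \<and> 0 < C \<and> (\<forall>f \<in> K_space i\<^sub>0 i\<^sub>1 \<theta> q.
      ennreal c * K_norm i\<^sub>0 i\<^sub>1 \<theta> q f \<le> J_norm i\<^sub>0 i\<^sub>1 \<theta> q f \<and>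
      J_norm i\<^sub>0 i\<^sub>1 \<theta> q f \<le> ennreal C * K_norm i\<^sub>0 i\<^sub>1 \<theta> q f)"
    using B K_le_J J_le_K by (intro exI[of _ "1 / B"] exI[of _ "8 / ln 2"]) auto
  ultimately show ?thesis by blast
qed

end
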